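(* Let $M$ be a surface in the Euclidean space $\mathbb R^3$ given locally as the graph of an analytic function $z=f(x,y)$ with $$f=\tfrac{\kappa}{2}(x^2+y^2)+\tfrac a6x^3+\tfrac b2xy^2+\tfrac c6y^3+\tfrac{d_{40}}{24}x^4+\tfrac{d_{31}}6x^3y+\tfrac{d_{22}}4x^2y^2+\tfrac{d_{13}}6xy^3+\tfrac{d_{04}}{24}y^4+O(5),$$ so that the origin is an umbilic point ${\rm p}$. If ${\rm p}$ is a ${\rm D}^1_2$-umbilic, that is, $cb(b-a)\neq0$ and either $\left(\frac{c}{2b}\right)^2-\frac ab+1=0$ or $a=2b$, then $m_u({\rm p})=1$. If ${\rm p}$ is a ${\rm D}^1_{2,3}$-umbilic, that is, $a=b\neq0$ and $\chi=c\,d_{31}-(d_{22}-d_{40}+2\kappa^3)b\neq0$, then $m_u({\rm p})=2$.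
   Context: For a surface in Euclidean space with local parametrisation $\mathbf x(x,y)=(x,y,f(x,y))$, let $E,F,G$ and $l,m,n$ be the coefficients of the first and second fundamental forms, and $\mathfrak a=Fn-Gm$, $\mathfrak b=En-Gl$, $\mathfrak c=Em-Fl$ the coefficients of the equation of the lines of principal curvature $\mathfrak a\,dy^2+\mathfrak b\,dx\,dy+\mathfrak c\,dx^2=0$. The multiplicity of the umbilic point at the origin (which counts the maximum number of umbilic points into which it can split under deformations of the surface) is $$m_u({\rm p})=\dim_{\mathbb C}\mathcal O_2/\langle\mathfrak b,\mathfrak c\rangle$$ (as $E\neq0$), where $\mathcal O_2$ is the ring of germs at the origin of holomorphic functions in two variables and $\mathfrak b,\mathfrak c$ are complexified. *)

theory Defs
  imports
    "HOL-Analysis.Analysis"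
    "HOL-Algebra.QuotRing"
    "HOL-Algebra.Embedded_Algebras"
    "HOL-Library.Landau_Symbols"
    "HOL-Library.Extended_Nat"
begin

unbundle no cross3_syntax

section \<open>Local differential geometry of a parametrised surface\<close>

definition partial_x :: "(real \<times> real \<Rightarrow> 'a::real_normed_vector) \<Rightarrow> real \<times> real \<Rightarrow> 'a" where
  "partial_x X p = vector_derivative (\<lambda>s. X (s, snd p)) (at (fst p))"

definition partial_y :: "(real \<times> real \<Rightarrow> 'a::real_normed_vector) \<Rightarrow> real \<times> real \<Rightarrow> 'a" where
  "partial_y X p = vector_derivative (\<lambda>t. X (fst p, t)) (at (snd p))"

definition graph_param :: "(real \<times> real \<Rightarrow> real) \<Rightarrow> real \<times> real \<Rightarrow> real ^ 3" where
  "graph_param f p = vector [fst p, snd p, f p]"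

definition unit_normal :: "(real \<times> real \<Rightarrow> real ^ 3) \<Rightarrow> real \<times> real \<Rightarrow> real ^ 3" where
  "unit_normal X p = sgn (cross3 (partial_x X p) (partial_y X p))"

definition coeff_E :: "(real \<times> real \<Rightarrow> real ^ 3) \<Rightarrow> real \<times> real \<Rightarrow> real" where
  "coeff_E X p = partial_x X p \<bullet> partial_x X p"

definition coeff_F :: "(real \<times> real \<Rightarrow> real ^ 3) \<Rightarrow> real \<times> real \<Rightarrow> real" where
  "coeff_F X p = partial_x X p \<bullet> partial_y X p"

definition coeff_G :: "(real \<times> real \<Rightarrow> real ^ 3) \<Rightarrow> real \<times> real \<Rightarrow> real" where
  "coeff_G X p = partial_y X p \<bullet> partial_y X p"

definition coeff_l :: "(real \<times> real \<Rightarrow> real ^ 3) \<Rightarrow> real \<times> real \<Rightarrow> real" where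
  "coeff_l X p = partial_x (partial_x X) p \<bullet> unit_normal X p"

definition coeff_m :: "(real \<times> real \<Rightarrow> real ^ 3) \<Rightarrow> real \<times> real \<Rightarrow> real" where
  "coeff_m X p = partial_y (partial_x X) p \<bullet> unit_normal X p"

definition coeff_n :: "(real \<times> real \<Rightarrow> real ^ 3) \<Rightarrow> real \<times> real \<Rightarrow> real" where
  "coeff_n X p = partial_y (partial_y X) p \<bullet> unit_normal X p"

text \<open>
  The lines of principal curvature are the solutions of
  \<open>\<aa> dy\<^sup>2 + \<bb> dx dy + \<cc> dx\<^sup>2 = 0\<close> with \<open>\<aa> = F n - G m\<close> and \<open>\<bb>\<close>, \<open>\<cc>\<close> as follows.
\<close>

definition lpc_b :: "(real \<times> real \<Rightarrow> real ^ 3) \<Rightarrow> real \<times> real \<Rightarrow> real" where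
  "lpc_b X p = coeff_E X p * coeff_n X p - coeff_G X p * coeff_l X p"

definition lpc_c :: "(real \<times> real \<Rightarrow> real ^ 3) \<Rightarrow> real \<times> real \<Rightarrow> real" where
  "lpc_c X p = coeff_E X p * coeff_m X p - coeff_F X p * coeff_l X p"

text \<open>Umbilic point: the second fundamental form is a multiple of the first.\<close>

definition umbilic_at :: "(real \<times> real \<Rightarrow> real ^ 3) \<Rightarrow> real \<times> real \<Rightarrow> bool" where
  "umbilic_at X p \<longleftrightarrow>
     (\<exists>k. coeff_l X p = k * coeff_E X p \<and>
          coeff_m X p = k * coeff_F X p \<and>
          coeff_n X p = k * coeff_G X p)"

section \<open>Analytic functions at the origin\<close>

definition real_analytic_at_origin :: "(real \<times> real \<Rightarrow> real) \<Rightarrow> bool" where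
  "real_analytic_at_origin f \<longleftrightarrow>
     (\<exists>(A :: nat \<times> nat \<Rightarrow> real) r. r > 0 \<and>
        (\<forall>x y. \<bar>x\<bar> < r \<and> \<bar>y\<bar> < r \<longrightarrow>
           ((\<lambda>(i, j). A (i, j) * x ^ i * y ^ j) has_sum f (x, y)) UNIV))"

text \<open>Holomorphic on some neighbourhood of the origin; the derivative is required to be complex linear.\<close>

definition holomorphic_at_origin :: "(complex \<times> complex \<Rightarrow> complex) \<Rightarrow> bool" where
  "holomorphic_at_origin h \<longleftrightarrow>
     (\<exists>U. open U \<and> (0, 0) \<in> U \<and>
        (\<forall>z\<in>U. \<exists>p q. (h has_derivative (\<lambda>(u, v). p * u + q * v)) (at z)))"

section \<open>The local ring of germs\<close>

text \<open>
  A germ is a class of functions, holomorphic near the origin, that agree on some neighbourhood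
  of the origin.  The ring of germs is accordingly the quotient of the ring of these functions by
  the ideal of those vanishing near the origin; values far from the origin play no role.
\<close>

definition hol_ring :: "(complex \<times> complex \<Rightarrow> complex) ring" where
  "hol_ring = \<lparr>carrier = {h. holomorphic_at_origin h},
     mult = (\<lambda>g h z. g z * h z), one = (\<lambda>_. 1),
     zero = (\<lambda>_. 0), add = (\<lambda>g h z. g z + h z)\<rparr>"

definition null_functions :: "(complex \<times> complex \<Rightarrow> complex) set" where
  "null_functions = {h. \<forall>\<^sub>F z in nhds (0, 0). h z = 0}"

type_synonym germ = "(complex \<times> complex \<Rightarrow> complex) set"

definition O2 :: "germ ring" where
  "O2 = hol_ring Quot null_functions"

definition germ_of :: "(complex \<times> complex \<Rightarrow> complex) \<Rightarrow> germ" where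
  "germ_of h = null_functions +>\<^bsub>hol_ring\<^esub> h"

text \<open>
  The complexification of a real analytic germ: the unique germ of a holomorphic function that
  extends it from the real plane.
\<close>

definition complexify :: "(real \<times> real \<Rightarrow> real) \<Rightarrow> germ" where
  "complexify g =
     (THE \<phi>. \<exists>h. holomorphic_at_origin h \<and> \<phi> = germ_of h \<and>
        (\<forall>\<^sub>F (x, y) in nhds (0, 0). h (of_real x, of_real y) = of_real (g (x, y))))"

text \<open>
  The dimension of \<open>O2/I\<close> over the complex numbers, these being embedded as the classes of the
  constant functions; \<open>\<infinity>\<close> if the dimension is not finite.
\<close>

definition constants_mod :: "germ set \<Rightarrow> germ set set" where
  "constants_mod I = range (\<lambda>k. I +>\<^bsub>O2\<^esub> germ_of (\<lambda>_. k))"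

definition quotient_dim :: "germ set \<Rightarrow> enat" where
  "quotient_dim I =
     (if ring.finite_dimension (O2 Quot I) (constants_mod I) (carrier (O2 Quot I))
      then enat ((ring.dim (O2 Quot I) over constants_mod I) (carrier (O2 Quot I)))
      else \<infinity>)"

text \<open>
  The multiplicity of the umbilic point \<open>X (0, 0)\<close>.  The coefficient \<open>\<aa>\<close> is omitted from the
  generators because \<open>E \<noteq> 0\<close> for every regular parametrisation and \<open>E \<aa> = F \<bb> - G \<cc>\<close>.
\<close>

definition umbilic_multiplicity :: "(real \<times> real \<Rightarrow> real ^ 3) \<Rightarrow> enat" where
  "umbilic_multiplicity X =
     quotient_dim (Idl\<^bsub>O2\<^esub> {complexify (lpc_b X), complexify (lpc_c X)})"

section \<open>Types of umbilic points, in terms of the Taylor coefficients\<close>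

definition D12_umbilic :: "real \<Rightarrow> real \<Rightarrow> real \<Rightarrow> bool" where
  "D12_umbilic a b c \<longleftrightarrow>
     c * b * (b - a) \<noteq> 0 \<and> ((c / (2 * b))\<^sup>2 - a / b + 1 = 0 \<or> a = 2 * b)"

definition D123_umbilic ::
    "real \<Rightarrow> real \<Rightarrow> real \<Rightarrow> real \<Rightarrow> real \<Rightarrow> real \<Rightarrow> real \<Rightarrow> bool" where
  "D123_umbilic \<kappa> a b c d40 d31 d22 \<longleftrightarrow>
     a = b \<and> b \<noteq> 0 \<and> c * d31 - (d22 - d40 + 2 * \<kappa> ^ 3) * b \<noteq> 0"

section \<open>The ring structure\<close>

lemma holomorphic_at_origin_const: "holomorphic_at_origin (\<lambda>_. k)"
  unfolding holomorphic_at_origin_def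
  by (rule exI[of _ UNIV]) (auto intro!: exI[of _ 0] simp: case_prod_unfold)

lemma holomorphic_at_origin_add:
  assumes "holomorphic_at_origin g" "holomorphic_at_origin h"
  shows "holomorphic_at_origin (\<lambda>z. g z + h z)"
proof -
  obtain U where U: "open U" "(0, 0) \<in> U"
    "\<And>z. z \<in> U \<Longrightarrow> \<exists>p q. (g has_derivative (\<lambda>(u, v). p * u + q * v)) (at z)"
    using assms(1) unfolding holomorphic_at_origin_def by blast
  obtain V where V: "open V" "(0, 0) \<in> V"
    "\<And>z. z \<in> V \<Longrightarrow> \<exists>p q. (h has_derivative (\<lambda>(u, v). p * u + q * v)) (at z)"
    using assms(2) unfolding holomorphic_at_origin_def by blast
  have "\<exists>p q. ((\<lambda>z. g z + h z) has_derivative (\<lambda>(u, v). p * u + q * v)) (at z)"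
    if z: "z \<in> U \<inter> V" for z
  proof -
    obtain p q where g: "(g has_derivative (\<lambda>(u, v). p * u + q * v)) (at z)" using U z by blast
    obtain r s where h: "(h has_derivative (\<lambda>(u, v). r * u + s * v)) (at z)" using V z by blast
    have "(\<lambda>z. (case z of (u, v) \<Rightarrow> p * u + q * v) + (case z of (u, v) \<Rightarrow> r * u + s * v))
        = (\<lambda>(u, v). (p + r) * u + (q + s) * v)"
      by (auto simp: fun_eq_iff algebra_simps)
    with has_derivative_add[OF g h] show ?thesis by metis
  qed
  with U V show ?thesis unfolding holomorphic_at_origin_def
    by (intro exI[of _ "U \<inter> V"]) auto
qed

lemma holomorphic_at_origin_mult:
  assumes "holomorphic_at_origin g" "holomorphic_at_origin h"
  shows "holomorphic_at_origin (\<lambda>z. g z * h z)"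
proof -
  obtain U where U: "open U" "(0, 0) \<in> U"
    "\<And>z. z \<in> U \<Longrightarrow> \<exists>p q. (g has_derivative (\<lambda>(u, v). p * u + q * v)) (at z)"
    using assms(1) unfolding holomorphic_at_origin_def by blast
  obtain V where V: "open V" "(0, 0) \<in> V"
    "\<And>z. z \<in> V \<Longrightarrow> \<exists>p q. (h has_derivative (\<lambda>(u, v). p * u + q * v)) (at z)"
    using assms(2) unfolding holomorphic_at_origin_def by blast
  have "\<exists>p q. ((\<lambda>z. g z * h z) has_derivative (\<lambda>(u, v). p * u + q * v)) (at z)"
    if z: "z \<in> U \<inter> V" for z
  proof -
    obtain p q where g: "(g has_derivative (\<lambda>(u, v). p * u + q * v)) (at z)" using U z by blast
    obtain r s where h: "(h has_derivative (\<lambda>(u, v). r * u + s * v)) (at z)" using V z by blast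
    have "(\<lambda>w. g z * (case w of (u, v) \<Rightarrow> r * u + s * v) + (case w of (u, v) \<Rightarrow> p * u + q * v) * h z)
        = (\<lambda>(u, v). (g z * r + p * h z) * u + (g z * s + q * h z) * v)"
      by (auto simp: fun_eq_iff algebra_simps)
    with has_derivative_mult[OF g h] show ?thesis by metis
  qed
  with U V show ?thesis unfolding holomorphic_at_origin_def
    by (intro exI[of _ "U \<inter> V"]) auto
qed

lemma null_functions_holomorphic:
  assumes "h \<in> null_functions"
  shows "holomorphic_at_origin h"
proof -
  obtain U where U: "open U" "(0, 0) \<in> U" "\<And>z. z \<in> U \<Longrightarrow> h z = 0"
    using assms unfolding null_functions_def eventually_nhds by auto
  have "(h has_derivative (\<lambda>(u, v). 0 * u + 0 * v)) (at z)" if "z \<in> U" for z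
  proof -
    have "((\<lambda>_. 0) has_derivative (\<lambda>_. 0)) (at z)" by simp
    hence "(h has_derivative (\<lambda>_. 0)) (at z)"
      by (rule has_derivative_transform_within_open[OF _ U(1) that]) (simp add: U(3))
    thus ?thesis by (simp add: case_prod_unfold)
  qed
  with U show ?thesis unfolding holomorphic_at_origin_def by blast
qed

lemma cring_hol_ring: "cring hol_ring"
proof (rule cringI)
  show "abelian_group hol_ring"
  proof (rule abelian_groupI)
    fix h assume "h \<in> carrier hol_ring"
    then have "holomorphic_at_origin (\<lambda>z. - 1 * h z)"
      using holomorphic_at_origin_mult[OF holomorphic_at_origin_const[of "- 1"]]
      by (simp add: hol_ring_def)
    then show "\<exists>g\<in>carrier hol_ring. g \<oplus>\<^bsub>hol_ring\<^esub> h = \<zero>\<^bsub>hol_ring\<^esub>"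
      by (intro bexI[of _ "\<lambda>z. - 1 * h z"]) (auto simp: hol_ring_def)
  qed (auto simp: hol_ring_def algebra_simps
        intro: holomorphic_at_origin_add holomorphic_at_origin_const)
  show "comm_monoid hol_ring"
    by (rule comm_monoidI)
       (auto simp: hol_ring_def algebra_simps
          intro: holomorphic_at_origin_mult holomorphic_at_origin_const)
qed (auto simp: hol_ring_def algebra_simps)

lemma ideal_null_functions: "ideal null_functions hol_ring"
proof (rule idealI)
  interpret cring hol_ring by (rule cring_hol_ring)
  show "ring hol_ring" by (rule ring_axioms)
  show "subgroup null_functions (add_monoid hol_ring)"
  proof (rule add.subgroupI)
    show "null_functions \<subseteq> carrier hol_ring"
      using null_functions_holomorphic by (auto simp: hol_ring_def)
    show "null_functions \<noteq> {}"
      by (auto simp: null_functions_def intro!: exI[of _ "\<lambda>_. 0"])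
  next
    fix h assume h: "h \<in> null_functions"
    define g where "g = (\<lambda>z. - h z)"
    have g: "g \<in> null_functions" using h by (simp add: null_functions_def g_def)
    have "\<ominus>\<^bsub>hol_ring\<^esub> h = g"
    proof (rule minus_equality)
      show "g \<oplus>\<^bsub>hol_ring\<^esub> h = \<zero>\<^bsub>hol_ring\<^esub>" by (simp add: g_def hol_ring_def)
    qed (use g h null_functions_holomorphic in \<open>auto simp: hol_ring_def\<close>)
    with g show "\<ominus>\<^bsub>hol_ring\<^esub> h \<in> null_functions" by simp
  next
    fix g h assume "g \<in> null_functions" "h \<in> null_functions"
    then show "g \<oplus>\<^bsub>hol_ring\<^esub> h \<in> null_functions"
      by (auto simp: null_functions_def hol_ring_def elim: eventually_elim2)
  qed
qed (auto simp: null_functions_def hol_ring_def elim: eventually_mono)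

lemma cring_O2: "cring O2"
  unfolding O2_def by (rule ideal.quotient_is_cring[OF ideal_null_functions cring_hol_ring])

end

theory Submission
  imports Defs "HOL-Complex_Analysis.Conformal_Mappings"
begin

text \<open>
  Write \<open>p, q\<close> for the first and \<open>r, s, t\<close> for the second derivatives \<open>f\<^sub>x\<^sub>x, f\<^sub>x\<^sub>y, f\<^sub>y\<^sub>y\<close> of \<open>f\<close>.  For the
  graph of \<open>f\<close> the two coefficients \<open>\<bb>\<close> and \<open>\<cc>\<close> are, up to the common factor
  \<open>1 / sqrt (1 + p\<^sup>2 + q\<^sup>2)\<close>, the expressions \<open>\<beta> = (1 + p\<^sup>2) t - (1 + q\<^sup>2) r\<close> and
  \<open>\<gamma> = (1 + p\<^sup>2) s - p q r\<close>.  The factor is a unit of the ring of germs, so the multiplicity is the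
  codimension of the ideal \<open>\<langle>\<beta>, \<gamma>\<rangle>\<close>.  With the given Taylor expansion of \<open>f\<close>,

  \<open>\<beta> = (b - a) x + c y + ((d22 - d40) / 2 + \<kappa>\<^sup>3) x\<^sup>2 + y (\<dots>) + \<dots>\<close> and
  \<open>\<gamma> = b y + (d31 / 2) x\<^sup>2 + y (\<dots>) + \<dots>\<close>,

  where the brackets vanish at the origin and the remaining terms are of order 3.

  If \<open>b (b - a) \<noteq> 0\<close>, the linear parts are independent, so that \<open>\<langle>\<beta>, \<gamma>\<rangle>\<close> is the maximal ideal
  \<open>\<langle>x, y\<rangle>\<close> and the codimension is 1.  If \<open>a = b\<close>, then modulo \<open>\<langle>x, y\<rangle> \<langle>x\<^sup>2, y\<rangle>\<close> both germs are linear
  combinations of \<open>x\<^sup>2\<close> and \<open>y\<close>, with determinant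
  \<open>((d22 - d40) / 2 + \<kappa>\<^sup>3) b - c d31 / 2 = - \<chi> / 2 \<noteq> 0\<close>; hence \<open>\<langle>\<beta>, \<gamma>\<rangle> = \<langle>x\<^sup>2, y\<rangle>\<close> and the codimension
  is 2.  Both cases are instances of two facts: two germs that are combinations of \<open>g\<^sub>1, g\<^sub>2\<close> with
  invertible determinant generate the same ideal as \<open>g\<^sub>1, g\<^sub>2\<close> (\<open>Idl_germs_unimodular\<close>), and
  \<open>\<langle>x\<^sup>N, y\<rangle>\<close> has codimension \<open>N\<close> (\<open>quotient_dim_fst_power_snd\<close>).

  What remains is the passage between real Taylor expansions and holomorphic germs.  A function that
  is continuous and holomorphic in each variable is holomorphic in both
  (\<open>hol_polydisc_has_derivative\<close>), which makes partial derivatives and the quotients in Hadamard's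
  lemma (\<open>hadamard_at_origin\<close>) holomorphic.  A holomorphic germ is determined by its values on the
  real plane (\<open>identity_real_plane\<close>), so a complexification can be recognised by any holomorphic
  extension.  Remainders of Taylor expansions are measured by the powers of the maximal ideal: an
  estimate \<open>O(k)\<close> on the real plane alone puts a holomorphic germ into the \<open>k\<close>-th power
  (\<open>ord_ge_from_real_bigo\<close>), and a partial derivative lowers the exponent by one only
  (\<open>ord_ge_cderiv_fst\<close>).
\<close>

section \<open>Holomorphic functions on bidiscs\<close>

text \<open>
  The base field is kept general because neighbourhoods of the origin are needed both in the real
  and in the complex plane.
\<close>

definition polydisc :: "real \<Rightarrow> ('a::real_normed_vector \<times> 'a) set" where
  "polydisc r = ball 0 r \<times> ball 0 r"

text \<open>
  The separate version of holomorphy is the one that can be checked with one-variable theory.  That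
  it coincides near the origin with complex differentiability is
  \<open>holomorphic_at_origin_iff_polydisc\<close> below.
\<close>

definition hol_polydisc :: "real \<Rightarrow> (complex \<times> complex \<Rightarrow> complex) \<Rightarrow> bool" where
  "hol_polydisc r h \<longleftrightarrow> continuous_on (polydisc r) h \<and>
     (\<forall>w\<in>ball 0 r. (\<lambda>z. h (z, w)) holomorphic_on ball 0 r) \<and>
     (\<forall>z\<in>ball 0 r. (\<lambda>w. h (z, w)) holomorphic_on ball 0 r)"

definition cderiv_fst :: "(complex \<times> complex \<Rightarrow> complex) \<Rightarrow> complex \<times> complex \<Rightarrow> complex" where
  "cderiv_fst h p = deriv (\<lambda>s. h (s, snd p)) (fst p)"

definition cderiv_snd :: "(complex \<times> complex \<Rightarrow> complex) \<Rightarrow> complex \<times> complex \<Rightarrow> complex" where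
  "cderiv_snd h p = deriv (\<lambda>s. h (fst p, s)) (snd p)"

lemma mem_polydisc [simp]: "(z, w) \<in> polydisc r \<longleftrightarrow> norm z < r \<and> norm w < r"
  by (simp add: polydisc_def)

lemma open_polydisc: "open (polydisc r)"
  unfolding polydisc_def by (intro open_Times open_ball)

lemma hol_polydisc_mono: "hol_polydisc r h \<Longrightarrow> s \<le> r \<Longrightarrow> hol_polydisc s h"
  unfolding hol_polydisc_def polydisc_def
  by (auto intro!: continuous_on_subset[of "ball 0 r \<times> ball 0 r" h "ball 0 s \<times> ball 0 s"]
      holomorphic_on_subset[of _ "ball 0 r" "ball 0 s"])

lemma hol_polydisc_continuous_on:
  assumes "hol_polydisc r h" "continuous_on S g" "g ` S \<subseteq> polydisc r"
  shows "continuous_on S (\<lambda>p. h (g p))"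
  using assms continuous_on_compose2[of "polydisc r" h S g] by (auto simp: hol_polydisc_def)

lemma hol_polydisc_has_deriv_fst:
  assumes "hol_polydisc r h" "norm z < r" "norm w < r"
  shows "((\<lambda>s. h (s, w)) has_field_derivative cderiv_fst h (z, w)) (at z)"
  using assms unfolding hol_polydisc_def cderiv_fst_def
  by (auto intro!: holomorphic_derivI[of _ "ball 0 r"])

lemma hol_polydisc_has_deriv_snd:
  assumes "hol_polydisc r h" "norm z < r" "norm w < r"
  shows "((\<lambda>s. h (z, s)) has_field_derivative cderiv_snd h (z, w)) (at w)"
  using assms unfolding hol_polydisc_def cderiv_snd_def
  by (auto intro!: holomorphic_derivI[of _ "ball 0 r"])

lemma hol_polydisc_swap:
  assumes "hol_polydisc r h"
  shows "hol_polydisc r (h \<circ> prod.swap)"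
proof -
  have "continuous_on (polydisc r) (\<lambda>p. h (prod.swap p))"
    by (rule hol_polydisc_continuous_on[OF assms])
       (auto simp: prod.swap_def intro!: continuous_intros)
  thus ?thesis using assms by (auto simp: hol_polydisc_def o_def)
qed

lemma cderiv_snd_swap: "cderiv_snd h = cderiv_fst (h \<circ> prod.swap) \<circ> prod.swap"
  by (auto simp: cderiv_snd_def cderiv_fst_def fun_eq_iff o_def)

definition circ :: "real \<Rightarrow> real \<Rightarrow> complex" where
  "circ \<rho> t = of_real \<rho> * exp (2 * of_real pi * \<i> * of_real t)"

lemma norm_circ: "\<rho> > 0 \<Longrightarrow> norm (circ \<rho> t) = \<rho>"
  by (simp add: circ_def norm_mult)

lemma circ_neq: "norm z < \<rho> \<Longrightarrow> circ \<rho> t \<noteq> z"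
  using norm_circ[of \<rho> t] norm_ge_zero[of z] by auto

lemma continuous_on_circ [continuous_intros]:
  "continuous_on S f \<Longrightarrow> continuous_on S (\<lambda>x. circ \<rho> (f x))"
  unfolding circ_def by (intro continuous_intros)

text \<open>
  Cauchy's formula for the derivative, with the other variable as a parameter.  It turns joint
  regularity of the derivative into regularity of an integral that depends on parameters.
\<close>

lemma cderiv_fst_integral:
  assumes h: "hol_polydisc r h" and "\<rho> < r" "norm z < \<rho>" "norm w < \<rho>"
  shows "cderiv_fst h (z, w) =
           integral (cbox 0 1) (\<lambda>t. h (circ \<rho> t, w) * (circ \<rho> t / (circ \<rho> t - z)\<^sup>2))"
proof -
  have hol: "(\<lambda>s. h (s, w)) holomorphic_on ball 0 r"
    using h assms by (auto simp: hol_polydisc_def)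
  have circ: "circlepath 0 \<rho> t = circ \<rho> t" for t
    by (simp add: circlepath circ_def)
  have "((\<lambda>s. h (s, w)) has_field_derivative
      (1 / (2 * of_real pi * \<i>) * contour_integral (circlepath 0 \<rho>) (\<lambda>u. h (u, w) / (u - z)\<^sup>2))) (at z)"
  proof (rule Cauchy_derivative_integral_circlepath)
    show "continuous_on (cball 0 \<rho>) (\<lambda>s. h (s, w))"
      using assms by (intro holomorphic_on_imp_continuous_on holomorphic_on_subset[OF hol]) auto
    show "(\<lambda>s. h (s, w)) holomorphic_on ball 0 \<rho>"
      using assms by (intro holomorphic_on_subset[OF hol]) auto
  qed (use assms in auto)
  then have "cderiv_fst h (z, w) = 1 / (2 * of_real pi * \<i>) *
      integral {0..1} (\<lambda>t. (2 * of_real pi * \<i>) * (h (circ \<rho> t, w) * (circ \<rho> t / (circ \<rho> t - z)\<^sup>2)))"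
    by (simp add: cderiv_fst_def DERIV_imp_deriv contour_integral_integral vector_derivative_circlepath
          circ) (simp add: circ_def mult_ac)
  then show ?thesis
    unfolding integral_mult_right by (simp add: cbox_interval)
qed

lemma hol_polydisc_cderiv_fst_continuous:
  assumes h: "hol_polydisc r h"
  shows "continuous_on (polydisc r) (cderiv_fst h)"
proof -
  have *: "continuous_on (polydisc \<rho>) (cderiv_fst h)" if \<rho>: "\<rho> < r" for \<rho>
  proof (cases "\<rho> > 0")
    case True
    have "continuous_on (polydisc \<rho>) (\<lambda>p.
           integral (cbox 0 1) (\<lambda>t. h (circ \<rho> t, snd p) * (circ \<rho> t / (circ \<rho> t - fst p)\<^sup>2)))"
    proof (rule integral_continuous_on_param)
      show "continuous_on (polydisc \<rho> \<times> cbox 0 1)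
         (\<lambda>(p, t). h (circ \<rho> t, snd p) * (circ \<rho> t / (circ \<rho> t - fst p)\<^sup>2))"
        unfolding case_prod_unfold using \<rho> True
        by (intro continuous_on_mult continuous_on_divide hol_polydisc_continuous_on[OF h] continuous_intros)
           (auto simp: norm_circ circ_neq)
    qed
    thus ?thesis
      by (rule continuous_on_eq) (auto simp: cderiv_fst_integral[OF h \<rho>])
  qed (auto simp: polydisc_def ball_empty)
  show ?thesis
    unfolding continuous_on_eq_continuous_at[OF open_polydisc]
  proof
    fix p :: "complex \<times> complex" assume "p \<in> polydisc r"
    then have "max (norm (fst p)) (norm (snd p)) < r" by (cases p) auto
    then obtain \<rho> where "max (norm (fst p)) (norm (snd p)) < \<rho>" "\<rho> < r" using dense by blast
    then show "isCont (cderiv_fst h) p"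
      using *[of \<rho>] unfolding continuous_on_eq_continuous_at[OF open_polydisc] by (cases p) auto
  qed
qed

lemma hol_polydisc_cderiv_snd_continuous:
  assumes "hol_polydisc r h"
  shows "continuous_on (polydisc r) (cderiv_snd h)"
  unfolding cderiv_snd_swap comp_def[of "cderiv_fst _"]
  by (rule continuous_on_compose2[OF hol_polydisc_cderiv_fst_continuous[OF hol_polydisc_swap[OF assms]]])
     (auto simp: prod.swap_def intro!: continuous_intros)

text \<open>
  Only holomorphy in the second variable is not immediate: it follows by differentiating Cauchy's
  formula under the integral sign, the derivative of the integrand being continuous.
\<close>

lemma hol_polydisc_cderiv_fst:
  assumes h: "hol_polydisc r h"
  shows "hol_polydisc r (cderiv_fst h)"
  unfolding hol_polydisc_def
proof (intro conjI ballI)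
  show "continuous_on (polydisc r) (cderiv_fst h)"
    by (rule hol_polydisc_cderiv_fst_continuous[OF h])
next
  fix w :: complex assume "w \<in> ball 0 r"
  then have "(\<lambda>z. h (z, w)) holomorphic_on ball 0 r" using h by (auto simp: hol_polydisc_def)
  then show "(\<lambda>z. cderiv_fst h (z, w)) holomorphic_on ball 0 r"
    by (simp add: cderiv_fst_def holomorphic_deriv)
next
  fix z :: complex assume z: "z \<in> ball 0 r"
  have *: "(\<lambda>w. cderiv_fst h (z, w)) holomorphic_on ball 0 \<rho>" if \<rho>: "norm z < \<rho>" "\<rho> < r" for \<rho>
  proof -
    let ?c = "circ \<rho>"
    have \<rho>0: "\<rho> > 0" using \<rho>(1) norm_ge_zero[of z] by linarith
    have cont: "continuous_on (ball 0 \<rho> \<times> cbox 0 1) (\<lambda>(w, t). g (?c t, w) * (?c t / (?c t - z)\<^sup>2))"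
      if g: "continuous_on (polydisc r) g" for g
      unfolding case_prod_unfold using \<rho> \<rho>0
      by (intro continuous_on_mult continuous_on_divide continuous_on_compose2[OF g] continuous_intros)
         (auto simp: norm_circ circ_neq)
    have "(\<lambda>w. integral (cbox 0 1) (\<lambda>t. h (?c t, w) * (?c t / (?c t - z)\<^sup>2))) holomorphic_on ball 0 \<rho>"
    proof (rule leibniz_rule_holomorphic)
      fix w :: complex and t :: real assume w: "w \<in> ball 0 \<rho>"
      have "((\<lambda>w. h (?c t, w)) has_field_derivative cderiv_snd h (?c t, w)) (at w)"
        using w \<rho> \<rho>0 by (intro hol_polydisc_has_deriv_snd[OF h]) (auto simp: norm_circ)
      then show "((\<lambda>w. h (?c t, w) * (?c t / (?c t - z)\<^sup>2)) has_field_derivative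
          cderiv_snd h (?c t, w) * (?c t / (?c t - z)\<^sup>2)) (at w within ball 0 \<rho>)"
        by (intro DERIV_cmult_right) (rule has_field_derivative_at_within)
    next
      fix w :: complex assume w: "w \<in> ball 0 \<rho>"
      have "continuous_on (cbox 0 1) (\<lambda>t. h (?c t, w) * (?c t / (?c t - z)\<^sup>2))"
        using \<rho> \<rho>0 w
        by (intro continuous_on_mult continuous_on_divide hol_polydisc_continuous_on[OF h] continuous_intros)
           (auto simp: norm_circ circ_neq)
      then show "(\<lambda>t. h (?c t, w) * (?c t / (?c t - z)\<^sup>2)) integrable_on cbox 0 1"
        by (rule integrable_continuous)
    next
      show "continuous_on (ball 0 \<rho> \<times> cbox 0 1)
          (\<lambda>(w, t). cderiv_snd h (?c t, w) * (?c t / (?c t - z)\<^sup>2))"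
        by (rule cont[OF hol_polydisc_cderiv_snd_continuous[OF h]])
    qed simp
    then show ?thesis
      by (rule holomorphic_transform) (use \<rho> in \<open>simp add: cderiv_fst_integral[OF h \<rho>(2)]\<close>)
  qed
  show "(\<lambda>w. cderiv_fst h (z, w)) holomorphic_on ball 0 r"
    unfolding holomorphic_on_open[OF open_ball]
  proof
    fix w :: complex assume "w \<in> ball 0 r"
    with z have "max (norm z) (norm w) < r" by auto
    then obtain \<rho> where \<rho>: "max (norm z) (norm w) < \<rho>" "\<rho> < r" using dense by blast
    then have "w \<in> ball 0 \<rho>" by simp
    with *[of \<rho>] \<rho> show "\<exists>f'. ((\<lambda>w. cderiv_fst h (z, w)) has_field_derivative f') (at w)"
      unfolding holomorphic_on_open[OF open_ball] by auto
  qed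
qed

lemma hol_polydisc_cderiv_snd:
  assumes "hol_polydisc r h"
  shows "hol_polydisc r (cderiv_snd h)"
  unfolding cderiv_snd_swap
  by (intro hol_polydisc_swap hol_polydisc_cderiv_fst assms)

text \<open>
  Osgood's lemma: a function with continuous partial derivatives is totally differentiable.
\<close>

lemma hol_polydisc_has_derivative:
  assumes h: "hol_polydisc r h" and "norm z < r" "norm w < r"
  shows "(h has_derivative (\<lambda>(u, v). cderiv_fst h (z, w) * u + cderiv_snd h (z, w) * v)) (at (z, w))"
proof -
  have "((\<lambda>(x, y). h (x, y)) has_derivative
     (\<lambda>(tx, ty). (*) (cderiv_fst h (z, w)) tx +
        blinfun_mult_right (cderiv_snd h (z, w)) ty)) (at (z, w) within ball 0 r \<times> ball 0 r)"
  proof (rule has_derivative_partialsI)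
    show "((\<lambda>x. h (x, w)) has_derivative (*) (cderiv_fst h (z, w))) (at z within ball 0 r)"
      using hol_polydisc_has_deriv_fst[OF assms]
      unfolding has_field_derivative_def by (rule has_derivative_at_withinI)
    show "((\<lambda>y. h (x, y)) has_derivative blinfun_apply (blinfun_mult_right (cderiv_snd h (x, y))))
        (at y within ball 0 r)" if "x \<in> ball 0 r" "y \<in> ball 0 r" for x y
    proof -
      have "((\<lambda>y. h (x, y)) has_derivative (*) (cderiv_snd h (x, y))) (at y within ball 0 r)"
        using has_field_derivative_imp_has_derivative[OF hol_polydisc_has_deriv_snd[OF h, of x y]] that
        by (simp add: has_derivative_at_withinI)
      thus ?thesis by (simp add: blinfun_mult_right.rep_eq)
    qed
    have "isCont (cderiv_snd h) (z, w)"
      using hol_polydisc_cderiv_snd_continuous[OF h] assms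
      unfolding continuous_on_eq_continuous_at[OF open_polydisc] by auto
    then show "continuous (at (z, w) within ball 0 r \<times> ball 0 r)
        (\<lambda>(x, y). blinfun_mult_right (cderiv_snd h (x, y)))"
      unfolding case_prod_unfold prod.collapse
      by (rule bounded_linear.continuous[OF bounded_linear_blinfun_mult_right,
            OF continuous_at_imp_continuous_within])
  qed (use assms in auto)
  moreover have "at (z, w) within ball 0 r \<times> ball 0 r = at (z, w)"
    using assms by (intro at_within_open open_Times) auto
  ultimately show ?thesis by (simp add: case_prod_unfold blinfun_mult_right.rep_eq)
qed

lemma eventually_nhds_origin_polydisc:
  fixes P :: "'a::real_normed_vector \<times> 'a \<Rightarrow> bool"
  shows "(\<forall>\<^sub>F p in nhds (0, 0). P p) \<longleftrightarrow> (\<exists>r>0. \<forall>p\<in>polydisc r. P p)"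
proof
  assume "\<forall>\<^sub>F p in nhds (0, 0). P p"
  then obtain S where S: "open S" "(0, 0) \<in> S" "\<And>p. p \<in> S \<Longrightarrow> P p"
    by (auto simp: eventually_nhds)
  then obtain A B where AB: "open A" "open B" "(0, 0) \<in> A \<times> B" "A \<times> B \<subseteq> S"
    using open_prod_elim[of S "(0, 0)"] by metis
  obtain r1 where r1: "r1 > 0" "ball 0 r1 \<subseteq> A" using AB open_contains_ball by blast
  obtain r2 where r2: "r2 > 0" "ball 0 r2 \<subseteq> B" using AB open_contains_ball by blast
  have "polydisc (min r1 r2) \<subseteq> S"
    using r1 r2 AB by (fastforce simp: polydisc_def)
  with S(3) r1 r2 show "\<exists>r>0. \<forall>p\<in>polydisc r. P p"
    by (intro exI[of _ "min r1 r2"]) auto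
next
  assume "\<exists>r>0. \<forall>p\<in>polydisc r. P p"
  then obtain r where r: "r > 0" "\<forall>p\<in>polydisc r. P p" by blast
  then show "\<forall>\<^sub>F p in nhds (0, 0). P p"
    unfolding eventually_nhds by (intro exI[of _ "polydisc r"] conjI open_polydisc ballI) auto
qed

lemma holomorphic_at_origin_iff_polydisc:
  "holomorphic_at_origin h \<longleftrightarrow> (\<exists>r>0. hol_polydisc r h)"
proof
  assume "holomorphic_at_origin h"
  then have "\<forall>\<^sub>F z in nhds (0, 0). \<exists>p q. (h has_derivative (\<lambda>(u, v). p * u + q * v)) (at z)"
    unfolding holomorphic_at_origin_def eventually_nhds by blast
  then obtain r where r: "r > 0"
    "\<And>z. z \<in> polydisc r \<Longrightarrow> \<exists>p q. (h has_derivative (\<lambda>(u, v). p * u + q * v)) (at z)"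
    by (auto simp: eventually_nhds_origin_polydisc)
  have "hol_polydisc r h"
    unfolding hol_polydisc_def
  proof (intro conjI ballI)
    show "continuous_on (polydisc r) h"
      using r(2) has_derivative_continuous
      by (fastforce intro: continuous_at_imp_continuous_on)
  next
    fix w :: complex assume w: "w \<in> ball 0 r"
    show "(\<lambda>z. h (z, w)) holomorphic_on ball 0 r"
      unfolding holomorphic_on_open[OF open_ball]
    proof
      fix z :: complex assume "z \<in> ball 0 r"
      with w r(2)[of "(z, w)"] obtain p q where
        d: "(h has_derivative (\<lambda>(u, v). p * u + q * v)) (at (z, w))" by auto
      have "((\<lambda>z. h (z, w)) has_derivative (\<lambda>z. case (z, 0) of (u, v) \<Rightarrow> p * u + q * v)) (at z)"
        by (rule has_derivative_compose[where f = "\<lambda>z. (z, w)", OF _ d]) (auto intro!: derivative_eq_intros)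
      then show "\<exists>f'. ((\<lambda>z. h (z, w)) has_field_derivative f') (at z)"
        by (auto simp: has_field_derivative_def)
    qed
  next
    fix z :: complex assume z: "z \<in> ball 0 r"
    show "(\<lambda>w. h (z, w)) holomorphic_on ball 0 r"
      unfolding holomorphic_on_open[OF open_ball]
    proof
      fix w :: complex assume "w \<in> ball 0 r"
      with z r(2)[of "(z, w)"] obtain p q where
        d: "(h has_derivative (\<lambda>(u, v). p * u + q * v)) (at (z, w))" by auto
      have "((\<lambda>w. h (z, w)) has_derivative (\<lambda>w. case (0, w) of (u, v) \<Rightarrow> p * u + q * v)) (at w)"
        by (rule has_derivative_compose[where f = "\<lambda>w. (z, w)", OF _ d]) (auto intro!: derivative_eq_intros)
      then show "\<exists>f'. ((\<lambda>w. h (z, w)) has_field_derivative f') (at w)"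
        by (auto simp: has_field_derivative_def)
    qed
  qed
  with r(1) show "\<exists>r>0. hol_polydisc r h" by blast
next
  assume "\<exists>r>0. hol_polydisc r h"
  then obtain r where r: "r > 0" "hol_polydisc r h" by blast
  show "holomorphic_at_origin h"
    unfolding holomorphic_at_origin_def
  proof (intro exI[of _ "polydisc r"] conjI ballI)
    fix z :: "complex \<times> complex" assume "z \<in> polydisc r"
    then show "\<exists>p q. (h has_derivative (\<lambda>(u, v). p * u + q * v)) (at z)"
      using hol_polydisc_has_derivative[OF r(2)] by (cases z) auto
  qed (use r open_polydisc in auto)
qed

text \<open>
  The quotient is \<open>q (z, w) = \<integral> (\<partial>\<^sub>1 h) (t z, w) dt\<close> over the unit interval.  In this form the points
  with \<open>z = 0\<close> are not exceptional, and differentiation under the integral sign gives holomorphy.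
\<close>

lemma hol_polydisc_divide_fst:
  assumes h: "hol_polydisc r h"
  shows "\<exists>q. hol_polydisc r q \<and> (\<forall>(z, w)\<in>polydisc r. h (z, w) = h (0, w) + z * q (z, w))"
proof -
  let ?D = "cderiv_fst h"
  note D = hol_polydisc_cderiv_fst[OF h]
  define q where "q = (\<lambda>p. integral (cbox 0 1) (\<lambda>t::real. ?D (of_real t * fst p, snd p)))"
  have sc: "norm (of_real t * z) < r" if "t \<in> cbox 0 1" "norm z < r" for t and z :: complex
  proof -
    have "norm (of_real t * z) \<le> 1 * norm z"
      unfolding norm_mult using that by (intro mult_right_mono) auto
    with that show ?thesis by simp
  qed
  have sc': "norm (of_real t * z) < r" if "0 \<le> t" "t \<le> 1" "norm z < r" for t and z :: complex
    using sc[of t z] that by simp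
  have cq: "continuous_on (polydisc r \<times> cbox 0 1) (\<lambda>(p, t). g (of_real t * fst p, snd p))"
    if g: "continuous_on (polydisc r) g" for g :: "complex \<times> complex \<Rightarrow> complex"
    unfolding case_prod_unfold
    by (rule continuous_on_compose2[OF g]) (auto intro!: continuous_intros sc')
  have contD: "continuous_on (polydisc r) ?D" using D by (simp add: hol_polydisc_def)
  have int: "(\<lambda>t. ?D (of_real t * z, w)) integrable_on cbox 0 1" if "norm z < r" "norm w < r" for z w
    by (rule integrable_continuous, rule continuous_on_compose2[OF contD])
       (use that in \<open>auto intro!: continuous_intros sc'\<close>)
  have "hol_polydisc r q"
    unfolding hol_polydisc_def
  proof (intro conjI ballI)
    show "continuous_on (polydisc r) q"
      unfolding q_def by (rule integral_continuous_on_param[OF cq[OF contD]])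
  next
    fix w :: complex assume w: "w \<in> ball 0 r"
    show "(\<lambda>z. q (z, w)) holomorphic_on ball 0 r"
      unfolding q_def fst_conv snd_conv
    proof (rule leibniz_rule_holomorphic)
      fix z :: complex and t :: real assume z: "z \<in> ball 0 r" "t \<in> cbox 0 1"
      have "((\<lambda>s. ?D (s, w)) has_field_derivative cderiv_fst ?D (of_real t * z, w)) (at (of_real t * z))"
        using z w by (intro hol_polydisc_has_deriv_fst[OF D]) (auto intro: sc')
      then have "((\<lambda>z. ?D (of_real t * z, w)) has_field_derivative
           cderiv_fst ?D (of_real t * z, w) * of_real t) (at z)"
        by (rule DERIV_chain2) (auto intro!: derivative_eq_intros)
      then show "((\<lambda>z. ?D (of_real t * z, w)) has_field_derivative
           cderiv_fst ?D (of_real t * z, w) * of_real t) (at z within ball 0 r)"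
        by (rule has_field_derivative_at_within)
    next
      show "continuous_on (ball 0 r \<times> cbox 0 1) (\<lambda>(z, t). cderiv_fst ?D (of_real t * z, w) * of_real t)"
        unfolding case_prod_unfold using w
        by (intro continuous_on_mult continuous_on_compose2[OF hol_polydisc_cderiv_fst_continuous[OF D]])
           (auto intro!: continuous_intros sc')
    qed (use w int in auto)
  next
    fix z :: complex assume z: "z \<in> ball 0 r"
    show "(\<lambda>w. q (z, w)) holomorphic_on ball 0 r"
      unfolding q_def fst_conv snd_conv
    proof (rule leibniz_rule_holomorphic)
      fix w :: complex and t :: real assume w: "w \<in> ball 0 r" "t \<in> cbox 0 1"
      have "((\<lambda>s. ?D (of_real t * z, s)) has_field_derivative cderiv_snd ?D (of_real t * z, w)) (at w)"
        using z w by (intro hol_polydisc_has_deriv_snd[OF D]) (auto intro: sc')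
      then show "((\<lambda>s. ?D (of_real t * z, s)) has_field_derivative cderiv_snd ?D (of_real t * z, w))
          (at w within ball 0 r)"
        by (rule has_field_derivative_at_within)
    next
      show "continuous_on (ball 0 r \<times> cbox 0 1) (\<lambda>(w, t). cderiv_snd ?D (of_real t * z, w))"
        unfolding case_prod_unfold using z
        by (intro continuous_on_compose2[OF hol_polydisc_cderiv_snd_continuous[OF D]])
           (auto intro!: continuous_intros sc')
    qed (use z int in auto)
  qed
  moreover have "h (z, w) = h (0, w) + z * q (z, w)" if zw: "norm z < r" "norm w < r" for z w
  proof -
    have "((\<lambda>t. z * ?D (of_real t * z, w)) has_integral
        (h (of_real 1 * z, w) - h (of_real 0 * z, w))) {0..1}"
    proof (rule fundamental_theorem_of_calculus)
      fix t :: real assume t: "t \<in> {0..1}"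
      have "((\<lambda>s. h (s, w)) has_field_derivative ?D (of_real t * z, w)) (at (of_real t * z))"
        using t zw by (intro hol_polydisc_has_deriv_fst[OF h]) (auto intro: sc')
      moreover have "((\<lambda>t. complex_of_real t * z) has_vector_derivative z) (at t within {0..1})"
        by (auto intro!: derivative_eq_intros simp: has_vector_derivative_def scaleR_conv_of_real)
      ultimately have "(((\<lambda>s. h (s, w)) \<circ> (\<lambda>t. complex_of_real t * z)) has_vector_derivative
          z * ?D (of_real t * z, w)) (at t within {0..1})"
        using field_vector_diff_chain_within has_field_derivative_at_within by blast
      then show "((\<lambda>t. h (of_real t * z, w)) has_vector_derivative z * ?D (of_real t * z, w))
          (at t within {0..1})" by (simp add: o_def)
    qed simp
    then have "h (z, w) - h (0, w) = integral {0..1} (\<lambda>t. z * ?D (of_real t * z, w))"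
      by (subst integral_unique) auto
    then show ?thesis by (simp add: q_def cbox_interval algebra_simps)
  qed
  ultimately show ?thesis by (intro exI[of _ q]) auto
qed

section \<open>Holomorphic germs and the identity theorem\<close>

lemma holomorphic_at_origin_cong:
  assumes "holomorphic_at_origin g" "\<forall>\<^sub>F p in nhds (0, 0). g p = h p"
  shows "holomorphic_at_origin h"
proof -
  have "(\<lambda>p. h p - g p) \<in> null_functions"
    using assms(2) by (auto simp: null_functions_def elim: eventually_mono)
  from holomorphic_at_origin_add[OF assms(1) null_functions_holomorphic[OF this]]
  show ?thesis by simp
qed

lemma holomorphic_at_origin_fst: "holomorphic_at_origin fst"
  and holomorphic_at_origin_snd: "holomorphic_at_origin snd"
proof -
  have "(fst has_derivative (\<lambda>(u, v). 1 * u + 0 * v)) (at z)" for z :: "complex \<times> complex"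
    using bounded_linear_imp_has_derivative[OF bounded_linear_fst, of "at z"]
    by (simp add: case_prod_unfold)
  then show "holomorphic_at_origin fst"
    unfolding holomorphic_at_origin_def using open_UNIV by blast
  have "(snd has_derivative (\<lambda>(u, v). 0 * u + 1 * v)) (at z)" for z :: "complex \<times> complex"
    using bounded_linear_imp_has_derivative[OF bounded_linear_snd, of "at z"]
    by (simp add: case_prod_unfold)
  then show "holomorphic_at_origin snd"
    unfolding holomorphic_at_origin_def using open_UNIV by blast
qed

lemma holomorphic_at_origin_isCont:
  assumes "holomorphic_at_origin h"
  shows "isCont h (0, 0)"
proof -
  obtain r where "r > 0" "continuous_on (polydisc r) h"
    using assms by (auto simp: holomorphic_at_origin_iff_polydisc hol_polydisc_def)
  then show ?thesis
    unfolding continuous_on_eq_continuous_at[OF open_polydisc] by auto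
qed

lemma holomorphic_at_origin_compose:
  assumes h: "holomorphic_at_origin h" and \<phi>: "\<phi> holomorphic_on S" "open S" "h (0, 0) \<in> S"
  shows "holomorphic_at_origin (\<lambda>p. \<phi> (h p))"
proof -
  obtain r where r: "r > 0" "hol_polydisc r h"
    using h by (auto simp: holomorphic_at_origin_iff_polydisc)
  have "(h \<longlongrightarrow> h (0, 0)) (nhds (0, 0))"
    using holomorphic_at_origin_isCont[OF h] by (simp add: isCont_def tendsto_at_iff_tendsto_nhds)
  from topological_tendstoD[OF this \<phi>(2,3)] have "\<forall>\<^sub>F p in nhds (0, 0). h p \<in> S" .
  then obtain s where s: "s > 0" "\<And>p. p \<in> polydisc s \<Longrightarrow> h p \<in> S"
    by (auto simp: eventually_nhds_origin_polydisc)
  define t where "t = min r s"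
  have t: "hol_polydisc t h" "\<And>p. p \<in> polydisc t \<Longrightarrow> h p \<in> S" "t > 0"
    using hol_polydisc_mono[OF r(2)] s r(1) by (auto simp: t_def)
  have "hol_polydisc t (\<lambda>p. \<phi> (h p))"
    unfolding hol_polydisc_def
  proof (intro conjI ballI)
    show "continuous_on (polydisc t) (\<lambda>p. \<phi> (h p))"
      using t by (intro continuous_on_compose2[OF holomorphic_on_imp_continuous_on[OF \<phi>(1)]])
        (auto simp: hol_polydisc_def)
    fix w :: complex assume w: "w \<in> ball 0 t"
    show "(\<lambda>z. \<phi> (h (z, w))) holomorphic_on ball 0 t" "(\<lambda>z. \<phi> (h (w, z))) holomorphic_on ball 0 t"
      using t(1) w t(2)
      by (auto simp: hol_polydisc_def intro!: holomorphic_on_compose_gen[OF _ \<phi>(1), unfolded o_def])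
  qed
  with t(3) show ?thesis by (auto simp: holomorphic_at_origin_iff_polydisc)
qed

lemma holomorphic_at_origin_inverse:
  "holomorphic_at_origin h \<Longrightarrow> h (0, 0) \<noteq> 0 \<Longrightarrow> holomorphic_at_origin (\<lambda>p. inverse (h p))"
  by (rule holomorphic_at_origin_compose[of h inverse "- {0}"]) (auto intro!: holomorphic_intros)

lemma holomorphic_at_origin_uminus:
  "holomorphic_at_origin h \<Longrightarrow> holomorphic_at_origin (\<lambda>p. - h p)"
  using holomorphic_at_origin_mult[OF holomorphic_at_origin_const[of "- 1"], of h] by simp

lemma holomorphic_at_origin_diff:
  "holomorphic_at_origin g \<Longrightarrow> holomorphic_at_origin h \<Longrightarrow> holomorphic_at_origin (\<lambda>p. g p - h p)"
  using holomorphic_at_origin_add[OF _ holomorphic_at_origin_uminus, of g h] by simp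

lemma holomorphic_at_origin_power:
  "holomorphic_at_origin h \<Longrightarrow> holomorphic_at_origin (\<lambda>p. h p ^ n)"
  by (induction n) (simp_all add: holomorphic_at_origin_const holomorphic_at_origin_mult)

lemma holomorphic_at_origin_divide_const:
  "holomorphic_at_origin h \<Longrightarrow> holomorphic_at_origin (\<lambda>p. h p / k)"
  using holomorphic_at_origin_mult[OF _ holomorphic_at_origin_const[of "inverse k"]]
  by (simp add: divide_inverse)

named_theorems hol_intros
lemmas [hol_intros] = holomorphic_at_origin_const holomorphic_at_origin_fst holomorphic_at_origin_snd
  holomorphic_at_origin_add holomorphic_at_origin_mult holomorphic_at_origin_uminus
  holomorphic_at_origin_diff holomorphic_at_origin_power holomorphic_at_origin_divide_const

lemma holomorphic_at_origin_swap:
  "holomorphic_at_origin h \<Longrightarrow> holomorphic_at_origin (h \<circ> prod.swap)"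
  unfolding holomorphic_at_origin_iff_polydisc using hol_polydisc_swap by blast

lemma holomorphic_at_origin_cderiv_fst:
  "holomorphic_at_origin h \<Longrightarrow> holomorphic_at_origin (cderiv_fst h)"
  unfolding holomorphic_at_origin_iff_polydisc using hol_polydisc_cderiv_fst by blast

lemma holomorphic_at_origin_cderiv_snd:
  "holomorphic_at_origin h \<Longrightarrow> holomorphic_at_origin (cderiv_snd h)"
  unfolding holomorphic_at_origin_iff_polydisc using hol_polydisc_cderiv_snd by blast

lemma eventually_nhds_origin_swap:
  fixes P :: "'a::real_normed_vector \<times> 'a \<Rightarrow> bool"
  assumes "\<forall>\<^sub>F p in nhds (0, 0). P p"
  shows "\<forall>\<^sub>F p in nhds (0, 0). P (prod.swap p)"
proof -
  obtain r where r: "r > 0" "\<And>p. p \<in> polydisc r \<Longrightarrow> P p"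
    using assms by (auto simp: eventually_nhds_origin_polydisc)
  have "P (prod.swap p)" if "p \<in> polydisc r" for p
    using that by (cases p) (auto intro!: r(2))
  with r(1) show ?thesis by (auto simp: eventually_nhds_origin_polydisc)
qed

lemma cderiv_fst_cong:
  assumes "\<forall>\<^sub>F p in nhds (0, 0). g p = h p"
  shows "\<forall>\<^sub>F p in nhds (0, 0). cderiv_fst g p = cderiv_fst h p"
proof -
  obtain r where r: "r > 0" "\<And>p. p \<in> polydisc r \<Longrightarrow> g p = h p"
    using assms by (auto simp: eventually_nhds_origin_polydisc)
  have "cderiv_fst g (z, w) = cderiv_fst h (z, w)" if "norm z < r" "norm w < r" for z w
    unfolding cderiv_fst_def
  proof (rule deriv_cong_ev)
    have "\<forall>\<^sub>F x in nhds z. x \<in> ball 0 r"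
      using that by (intro eventually_nhds_in_open) auto
    then show "\<forall>\<^sub>F x in nhds (fst (z, w)). g (x, snd (z, w)) = h (x, snd (z, w))"
      using that by (auto elim!: eventually_mono intro!: r(2))
  qed auto
  with r(1) show ?thesis by (auto simp: eventually_nhds_origin_polydisc)
qed

text \<open>
  The maximal ideal of the ring of germs is generated by the two coordinates.  One divides
  \<open>h (z, w) - h (0, w)\<close> by \<open>z\<close> and then \<open>h (0, w) - h (0, 0)\<close> by \<open>w\<close>.
\<close>

lemma hadamard_at_origin:
  assumes h: "holomorphic_at_origin h"
  obtains g1 g2 where "holomorphic_at_origin g1" "holomorphic_at_origin g2"
    "\<forall>\<^sub>F p in nhds (0, 0). h p = h (0, 0) + fst p * g1 p + snd p * g2 p"
proof -
  obtain r where r: "r > 0" "hol_polydisc r h"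
    using h by (auto simp: holomorphic_at_origin_iff_polydisc)
  obtain g1 where g1: "hol_polydisc r g1" "\<And>z w. (z, w) \<in> polydisc r \<Longrightarrow> h (z, w) = h (0, w) + z * g1 (z, w)"
    using hol_polydisc_divide_fst[OF r(2)] by blast
  define k where "k = (\<lambda>p :: complex \<times> complex. h (0, fst p))"
  have "hol_polydisc r k"
    unfolding hol_polydisc_def
  proof (intro conjI ballI)
    show "continuous_on (polydisc r) k"
      unfolding k_def
      by (rule hol_polydisc_continuous_on[OF r(2)]) (use r(1) in \<open>auto intro!: continuous_intros\<close>)
    show "(\<lambda>z. k (z, w)) holomorphic_on ball 0 r" for w
      using r by (simp add: k_def hol_polydisc_def)
    show "(\<lambda>w. k (z, w)) holomorphic_on ball 0 r" for z
      by (simp add: k_def)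
  qed
  then obtain g2 where g2: "hol_polydisc r g2" "\<And>z w. (z, w) \<in> polydisc r \<Longrightarrow> k (z, w) = k (0, w) + z * g2 (z, w)"
    using hol_polydisc_divide_fst by blast
  have "\<forall>p\<in>polydisc r. h p = h (0, 0) + fst p * g1 p + snd p * (g2 \<circ> prod.swap) p"
  proof clarify
    fix z w :: complex assume "(z, w) \<in> polydisc r"
    with g1(2)[of z w] g2(2)[of w z]
    show "h (z, w) = h (0, 0) + fst (z, w) * g1 (z, w) + snd (z, w) * (g2 \<circ> prod.swap) (z, w)"
      by (simp add: k_def)
  qed
  then have "\<forall>\<^sub>F p in nhds (0, 0). h p = h (0, 0) + fst p * g1 p + snd p * (g2 \<circ> prod.swap) p"
    unfolding eventually_nhds_origin_polydisc using r(1) by blast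
  moreover have "holomorphic_at_origin g1" "holomorphic_at_origin (g2 \<circ> prod.swap)"
    using g1(1) hol_polydisc_swap[OF g2(1)] r(1) unfolding holomorphic_at_origin_iff_polydisc by blast+
  ultimately show thesis using that by blast
qed

lemma islimpt_of_real_segment:
  assumes "r > 0"
  shows "(0::complex) islimpt of_real ` {-r<..<r}"
proof -
  show ?thesis
    unfolding islimpt_approachable
  proof safe
    fix e :: real assume e: "e > 0"
    let ?x = "min (e / 2) (r / 2)"
    have "complex_of_real ?x \<in> of_real ` {-r<..<r}"
      using e assms by (intro imageI) auto
    moreover have "dist (complex_of_real ?x) 0 < e" "complex_of_real ?x \<noteq> 0"
      using e assms by auto
    ultimately show "\<exists>x'\<in>complex_of_real ` {-r<..<r}. x' \<noteq> 0 \<and> dist x' 0 < e" by blast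
  qed
qed

text \<open>
  Two applications of the identity theorem in one variable: it removes the restriction to real
  values first from \<open>z\<close>, with \<open>w\<close> real, and then from \<open>w\<close>.
\<close>

lemma identity_real_plane:
  assumes h: "holomorphic_at_origin h"
    and "\<forall>\<^sub>F (x, y) in nhds (0, 0). h (of_real x, of_real y) = 0"
  shows "\<forall>\<^sub>F p in nhds (0, 0). h p = 0"
proof -
  obtain r1 where r1: "r1 > 0" "hol_polydisc r1 h"
    using h by (auto simp: holomorphic_at_origin_iff_polydisc)
  obtain r2 where r2: "r2 > 0" "\<And>x y :: real. (x, y) \<in> polydisc r2 \<Longrightarrow> h (of_real x, of_real y) = 0"
    using assms(2) unfolding eventually_nhds_origin_polydisc by blast
  define r where "r = min r1 r2"
  have r: "r > 0" "hol_polydisc r h" "\<And>x y. \<bar>x\<bar> < r \<Longrightarrow> \<bar>y\<bar> < r \<Longrightarrow> h (of_real x, of_real y) = 0"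
    using r1 r2 hol_polydisc_mono[OF r1(2)] by (auto simp: r_def)
  have real_snd: "h (z, of_real y) = 0" if "norm z < r" "\<bar>y\<bar> < r" for z y
  proof (rule analytic_continuation[where U = "of_real ` {-r<..<r}" and S = "ball 0 r" and \<xi> = 0
        and f = "\<lambda>z. h (z, of_real y)"])
    show "(\<lambda>z. h (z, of_real y)) holomorphic_on ball 0 r"
      using r(2) that by (auto simp: hol_polydisc_def)
    show "(0::complex) islimpt of_real ` {-r<..<r}" by (rule islimpt_of_real_segment[OF r(1)])
  qed (use that r in auto)
  have "h (z, w) = 0" if "norm z < r" "norm w < r" for z w
  proof (rule analytic_continuation[where U = "of_real ` {-r<..<r}" and S = "ball 0 r" and \<xi> = 0
        and f = "\<lambda>w. h (z, w)"])
    show "(\<lambda>w. h (z, w)) holomorphic_on ball 0 r"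
      using r(2) that by (auto simp: hol_polydisc_def)
    show "(0::complex) islimpt of_real ` {-r<..<r}" by (rule islimpt_of_real_segment[OF r(1)])
  qed (use that r real_snd in auto)
  with r(1) show ?thesis by (auto simp: eventually_nhds_origin_polydisc)
qed

section \<open>Powers of the maximal ideal\<close>

text \<open>
  Membership in the \<open>k\<close>-th power of the maximal ideal.  The recursion expresses that this power is
  generated by the two coordinates over the preceding one.
\<close>

fun ord_ge :: "nat \<Rightarrow> (complex \<times> complex \<Rightarrow> complex) \<Rightarrow> bool" where
  "ord_ge 0 h = holomorphic_at_origin h"
| "ord_ge (Suc k) h = (\<exists>g1 g2. ord_ge k g1 \<and> ord_ge k g2 \<and>
     (\<forall>\<^sub>F p in nhds (0, 0). h p = fst p * g1 p + snd p * g2 p))"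

lemma ord_ge_SucI:
  "ord_ge k g1 \<Longrightarrow> ord_ge k g2 \<Longrightarrow> \<forall>\<^sub>F p in nhds (0, 0). h p = fst p * g1 p + snd p * g2 p \<Longrightarrow> ord_ge (Suc k) h"
  unfolding ord_ge.simps by blast

lemma ord_ge_SucE:
  assumes "ord_ge (Suc k) e"
  obtains g h where "ord_ge k g" "ord_ge k h" "\<forall>\<^sub>F p in nhds (0, 0). e p = fst p * g p + snd p * h p"
  using assms unfolding ord_ge.simps(2) by blast

lemma ord_ge_holomorphic: "ord_ge k h \<Longrightarrow> holomorphic_at_origin h"
proof (induction k arbitrary: h)
  case (Suc k)
  then obtain g1 g2 where g: "ord_ge k g1" "ord_ge k g2"
    "\<forall>\<^sub>F p in nhds (0, 0). h p = fst p * g1 p + snd p * g2 p" by auto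
  have "holomorphic_at_origin (\<lambda>p. fst p * g1 p + snd p * g2 p)"
    by (intro hol_intros Suc.IH g)
  then show ?case
    by (rule holomorphic_at_origin_cong) (use g(3) in \<open>auto elim: eventually_mono\<close>)
qed simp

lemma ord_ge_cong:
  assumes "ord_ge k g" "\<forall>\<^sub>F p in nhds (0, 0). g p = h p"
  shows "ord_ge k h"
proof (cases k)
  case 0
  then show ?thesis using assms holomorphic_at_origin_cong by auto
next
  case (Suc j)
  with assms obtain g1 g2 where g: "ord_ge j g1" "ord_ge j g2"
    "\<forall>\<^sub>F p in nhds (0, 0). g p = fst p * g1 p + snd p * g2 p" by auto
  from g(3) assms(2) have "\<forall>\<^sub>F p in nhds (0, 0). h p = fst p * g1 p + snd p * g2 p"
    by eventually_elim simp
  with g Suc show ?thesis by auto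
qed

lemma ord_ge_add: "ord_ge k g \<Longrightarrow> ord_ge k h \<Longrightarrow> ord_ge k (\<lambda>p. g p + h p)"
proof (induction k arbitrary: g h)
  case (Suc k)
  from Suc.prems obtain g1 g2 where g: "ord_ge k g1" "ord_ge k g2"
    "\<forall>\<^sub>F p in nhds (0, 0). g p = fst p * g1 p + snd p * g2 p" by auto
  from Suc.prems obtain h1 h2 where h: "ord_ge k h1" "ord_ge k h2"
    "\<forall>\<^sub>F p in nhds (0, 0). h p = fst p * h1 p + snd p * h2 p" by auto
  from g(3) h(3) have "\<forall>\<^sub>F p in nhds (0, 0). g p + h p = fst p * (g1 p + h1 p) + snd p * (g2 p + h2 p)"
    by eventually_elim (simp add: algebra_simps)
  with Suc.IH[OF g(1) h(1)] Suc.IH[OF g(2) h(2)] show ?case by (intro ord_ge_SucI)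
qed (simp add: holomorphic_at_origin_add)

lemma ord_ge_holomorphic_mult:
  "holomorphic_at_origin u \<Longrightarrow> ord_ge k h \<Longrightarrow> ord_ge k (\<lambda>p. u p * h p)"
proof (induction k arbitrary: h)
  case (Suc k)
  from Suc.prems obtain h1 h2 where h: "ord_ge k h1" "ord_ge k h2"
    "\<forall>\<^sub>F p in nhds (0, 0). h p = fst p * h1 p + snd p * h2 p" by auto
  from h(3) have "\<forall>\<^sub>F p in nhds (0, 0). u p * h p = fst p * (u p * h1 p) + snd p * (u p * h2 p)"
    by eventually_elim (simp add: algebra_simps)
  with Suc.IH[OF Suc.prems(1) h(1)] Suc.IH[OF Suc.prems(1) h(2)] show ?case by (intro ord_ge_SucI)
qed (simp add: holomorphic_at_origin_mult)

lemma ord_ge_uminus: "ord_ge k h \<Longrightarrow> ord_ge k (\<lambda>p. - h p)"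
  using ord_ge_holomorphic_mult[OF holomorphic_at_origin_const[of "- 1"], of k h] by simp

lemma ord_ge_diff: "ord_ge k g \<Longrightarrow> ord_ge k h \<Longrightarrow> ord_ge k (\<lambda>p. g p - h p)"
  using ord_ge_add[OF _ ord_ge_uminus, of k g h] by simp

lemma ord_ge_mult: "ord_ge i g \<Longrightarrow> ord_ge j h \<Longrightarrow> ord_ge (i + j) (\<lambda>p. g p * h p)"
proof (induction i arbitrary: g)
  case (Suc i)
  from Suc.prems obtain g1 g2 where g: "ord_ge i g1" "ord_ge i g2"
    "\<forall>\<^sub>F p in nhds (0, 0). g p = fst p * g1 p + snd p * g2 p" by auto
  from g(3) have "\<forall>\<^sub>F p in nhds (0, 0). g p * h p = fst p * (g1 p * h p) + snd p * (g2 p * h p)"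
    by eventually_elim (simp add: algebra_simps)
  with Suc.IH[OF g(1) Suc.prems(2)] Suc.IH[OF g(2) Suc.prems(2)] show ?case
    unfolding add_Suc by (intro ord_ge_SucI)
qed (simp add: ord_ge_holomorphic_mult)

lemma ord_ge_SucD: "ord_ge (Suc k) h \<Longrightarrow> ord_ge k h"
proof (induction k arbitrary: h)
  case 0
  then show ?case using ord_ge_holomorphic[of "Suc 0" h] by simp
next
  case (Suc k)
  from Suc.prems obtain h1 h2 where h: "ord_ge (Suc k) h1" "ord_ge (Suc k) h2"
    "\<forall>\<^sub>F p in nhds (0, 0). h p = fst p * h1 p + snd p * h2 p" by auto
  from Suc.IH[OF h(1)] Suc.IH[OF h(2)] h(3) show ?case by (rule ord_ge_SucI)
qed

lemma ord_ge_mono: "ord_ge k h \<Longrightarrow> j \<le> k \<Longrightarrow> ord_ge j h"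
proof (induction k)
  case (Suc k)
  show ?case
  proof (cases "j = Suc k")
    case True
    with Suc.prems show ?thesis by blast
  next
    case False
    with Suc.prems have "j \<le> k" by simp
    with Suc.IH[OF ord_ge_SucD[OF Suc.prems(1)]] show ?thesis .
  qed
qed simp

text \<open>
  One direction is Hadamard's lemma.
\<close>

lemma ord_ge_1_iff: "ord_ge 1 h \<longleftrightarrow> holomorphic_at_origin h \<and> h (0, 0) = 0"
proof
  assume h: "ord_ge 1 h"
  then obtain g1 g2 where "\<forall>\<^sub>F p in nhds (0, 0). h p = fst p * g1 p + snd p * g2 p"
    unfolding One_nat_def ord_ge.simps by blast
  from eventually_nhds_x_imp_x[OF this] have "h (0, 0) = 0" by simp
  with ord_ge_holomorphic[OF h] show "holomorphic_at_origin h \<and> h (0, 0) = 0" by simp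
next
  assume h: "holomorphic_at_origin h \<and> h (0, 0) = 0"
  obtain g1 g2 where g: "holomorphic_at_origin g1" "holomorphic_at_origin g2"
    "\<forall>\<^sub>F p in nhds (0, 0). h p = h (0, 0) + fst p * g1 p + snd p * g2 p"
    using hadamard_at_origin h by blast
  show "ord_ge 1 h"
    unfolding One_nat_def using g h by (intro ord_ge_SucI[of 0 g1 g2]) simp_all
qed

lemma ord_ge_fst: "ord_ge 1 fst" and ord_ge_snd: "ord_ge 1 snd"
  by (simp_all only: ord_ge_1_iff holomorphic_at_origin_fst holomorphic_at_origin_snd) simp_all

lemma ord_ge_swap: "ord_ge k h \<Longrightarrow> ord_ge k (h \<circ> prod.swap)"
proof (induction k arbitrary: h)
  case (Suc k)
  from Suc.prems obtain h1 h2 where h: "ord_ge k h1" "ord_ge k h2"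
    "\<forall>\<^sub>F p in nhds (0, 0). h p = fst p * h1 p + snd p * h2 p" by auto
  have "\<forall>\<^sub>F p in nhds (0, 0). (h \<circ> prod.swap) p = fst p * (h2 \<circ> prod.swap) p + snd p * (h1 \<circ> prod.swap) p"
    using eventually_nhds_origin_swap[OF h(3)] by eventually_elim simp
  with Suc.IH[OF h(1)] Suc.IH[OF h(2)] show ?case by (intro ord_ge_SucI)
qed (simp add: holomorphic_at_origin_swap)

text \<open>
  By the product rule \<open>\<partial>\<^sub>1 (z h\<^sub>1 + w h\<^sub>2) = h\<^sub>1 + z \<partial>\<^sub>1 h\<^sub>1 + w \<partial>\<^sub>1 h\<^sub>2\<close>, and induction applies to the
  derivatives of \<open>h\<^sub>1\<close> and \<open>h\<^sub>2\<close>.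
\<close>

lemma ord_ge_cderiv_fst: "ord_ge (Suc k) h \<Longrightarrow> ord_ge k (cderiv_fst h)"
proof (induction k arbitrary: h)
  case 0
  then show ?case using ord_ge_holomorphic[of "Suc 0" h] holomorphic_at_origin_cderiv_fst by auto
next
  case (Suc k)
  from Suc.prems obtain h1 h2 where h: "ord_ge (Suc k) h1" "ord_ge (Suc k) h2"
    "\<forall>\<^sub>F p in nhds (0, 0). h p = fst p * h1 p + snd p * h2 p" by auto
  obtain r1 r2 where "r1 > 0" "r2 > 0" "hol_polydisc r1 h1" "hol_polydisc r2 h2"
    using ord_ge_holomorphic[OF h(1)] ord_ge_holomorphic[OF h(2)]
    by (auto simp: holomorphic_at_origin_iff_polydisc)
  then obtain r where r: "r > 0" "hol_polydisc r h1" "hol_polydisc r h2"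
    using hol_polydisc_mono[of _ _ "min r1 r2"] by (metis min.cobounded1 min.cobounded2 min_less_iff_conj)
  have "cderiv_fst (\<lambda>p. fst p * h1 p + snd p * h2 p) p =
      (h1 p + fst p * cderiv_fst h1 p) + snd p * cderiv_fst h2 p" if p: "p \<in> polydisc r" for p
  proof -
    obtain z w where zw: "p = (z, w)" "norm z < r" "norm w < r" using p by (cases p) auto
    note d = hol_polydisc_has_deriv_fst[OF r(2) zw(2,3)] hol_polydisc_has_deriv_fst[OF r(3) zw(2,3)]
    have "((\<lambda>s. s * h1 (s, w) + w * h2 (s, w)) has_field_derivative
       (1 * h1 (z, w) + cderiv_fst h1 (z, w) * z) + w * cderiv_fst h2 (z, w)) (at z)"
      by (intro DERIV_add DERIV_mult DERIV_cmult d DERIV_ident)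
    then show ?thesis
      unfolding zw cderiv_fst_def by (simp add: DERIV_imp_deriv algebra_simps)
  qed
  then have "\<forall>\<^sub>F p in nhds (0, 0). cderiv_fst (\<lambda>p. fst p * h1 p + snd p * h2 p) p =
      (h1 p + fst p * cderiv_fst h1 p) + snd p * cderiv_fst h2 p"
    using r(1) by (auto simp: eventually_nhds_origin_polydisc)
  with cderiv_fst_cong[OF h(3)]
  have ev: "\<forall>\<^sub>F p in nhds (0, 0). (h1 p + fst p * cderiv_fst h1 p) + snd p * cderiv_fst h2 p = cderiv_fst h p"
    by eventually_elim simp
  have "ord_ge (Suc k) (\<lambda>p. (h1 p + fst p * cderiv_fst h1 p) + snd p * cderiv_fst h2 p)"
    using ord_ge_mult[OF ord_ge_fst Suc.IH[OF h(1)]] ord_ge_mult[OF ord_ge_snd Suc.IH[OF h(2)]] h(1)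
    by (intro ord_ge_add) (simp_all only: plus_1_eq_Suc)
  then show ?case using ev by (rule ord_ge_cong)
qed

lemma ord_ge_bigo: "ord_ge k h \<Longrightarrow> h \<in> O[nhds (0, 0)](\<lambda>p. of_real (norm p ^ k))"
proof (induction k arbitrary: h)
  case 0
  then have "(h \<longlongrightarrow> h (0, 0)) (nhds (0, 0))"
    using holomorphic_at_origin_isCont by (simp add: isCont_def tendsto_at_iff_tendsto_nhds)
  then have "\<forall>\<^sub>F p in nhds (0, 0). norm (h p) < norm (h (0, 0)) + 1"
    by (intro order_tendstoD(2)[OF tendsto_norm]) auto
  then show ?case
    by (intro bigoI[of _ "norm (h (0, 0)) + 1"]) (auto elim: eventually_mono)
next
  case (Suc k)
  from Suc.prems obtain h1 h2 where h: "ord_ge k h1" "ord_ge k h2"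
    "\<forall>\<^sub>F p in nhds (0, 0). h p = fst p * h1 p + snd p * h2 p" by auto
  have "fst \<in> O[nhds (0 :: complex, 0 :: complex)](\<lambda>p. of_real (norm p) :: complex)"
    by (intro bigoI[of _ 1] always_eventually) (auto intro: norm_fst_le)
  moreover have "snd \<in> O[nhds (0 :: complex, 0 :: complex)](\<lambda>p. of_real (norm p) :: complex)"
    by (intro bigoI[of _ 1] always_eventually) (auto intro: norm_snd_le)
  ultimately have "(\<lambda>p. fst p * h1 p + snd p * h2 p) \<in> O[nhds (0, 0)](\<lambda>p. of_real (norm p) * of_real (norm p ^ k))"
    using Suc.IH[OF h(1)] Suc.IH[OF h(2)] by (intro sum_in_bigo landau_o.big.mult)
  also have "?this \<longleftrightarrow> h \<in> O[nhds (0, 0)](\<lambda>p. of_real (norm p ^ Suc k))"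
    by (rule landau_o.big.cong_ex) (use h(3) in \<open>auto elim: eventually_mono\<close>)
  finally show ?case .
qed

text \<open>
  The leading part is the homogeneous polynomial of degree \<open>k\<close> in the Taylor expansion.
  Homogeneity under real factors stands in for an explicit list of its coefficients.
\<close>

lemma ord_ge_leading_part:
  assumes "ord_ge k h"
  obtains q where "holomorphic_at_origin q"
    "\<And>t p. q (t *\<^sub>R p) = of_real t ^ k * q p" "ord_ge (Suc k) (\<lambda>p. h p - q p)"
  using assms
proof (induction k arbitrary: h thesis)
  case 0
  show ?case
  proof (rule "0.prems"(1)[of "\<lambda>_. h (0, 0)"])
    have "ord_ge 1 (\<lambda>p. h p - h (0, 0))"
      using "0.prems"(2) unfolding ord_ge_1_iff by (auto intro!: hol_intros)
    then show "ord_ge (Suc 0) (\<lambda>p. h p - h (0, 0))" by simp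
  qed (auto intro: hol_intros)
next
  case (Suc k)
  from Suc.prems obtain h1 h2 where h: "ord_ge k h1" "ord_ge k h2"
    "\<forall>\<^sub>F p in nhds (0, 0). h p = fst p * h1 p + snd p * h2 p" by auto
  obtain q1 where q1: "holomorphic_at_origin q1" "\<And>t p. q1 (t *\<^sub>R p) = of_real t ^ k * q1 p"
    "ord_ge (Suc k) (\<lambda>p. h1 p - q1 p)" using Suc.IH[OF _ h(1)] by blast
  obtain q2 where q2: "holomorphic_at_origin q2" "\<And>t p. q2 (t *\<^sub>R p) = of_real t ^ k * q2 p"
    "ord_ge (Suc k) (\<lambda>p. h2 p - q2 p)" using Suc.IH[OF _ h(2)] by blast
  show ?case
  proof (rule Suc.prems(1)[of "\<lambda>p. fst p * q1 p + snd p * q2 p"])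
    show "holomorphic_at_origin (\<lambda>p. fst p * q1 p + snd p * q2 p)"
      by (intro hol_intros q1 q2)
    show "fst (t *\<^sub>R p) * q1 (t *\<^sub>R p) + snd (t *\<^sub>R p) * q2 (t *\<^sub>R p) =
        of_real t ^ Suc k * (fst p * q1 p + snd p * q2 p)" for t p
      by (simp add: q1 q2 scaleR_conv_of_real algebra_simps)
    have "\<forall>\<^sub>F p in nhds (0, 0). h p - (fst p * q1 p + snd p * q2 p) =
        fst p * (h1 p - q1 p) + snd p * (h2 p - q2 p)"
      using h(3) by eventually_elim (simp add: algebra_simps)
    with q1(3) q2(3) show "ord_ge (Suc (Suc k)) (\<lambda>p. h p - (fst p * q1 p + snd p * q2 p))"
      by (rule ord_ge_SucI)
  qed
qed

definition complex_point :: "real \<times> real \<Rightarrow> complex \<times> complex" where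
  "complex_point v = (of_real (fst v), of_real (snd v))"

lemma norm_complex_point [simp]: "norm (complex_point v) = norm v"
  by (simp add: complex_point_def norm_prod_def)

lemma filterlim_complex_point: "filterlim complex_point (nhds (0, 0)) (nhds (0, 0))"
proof -
  have "isCont complex_point (0, 0)"
    unfolding complex_point_def by (intro continuous_intros)
  moreover have "complex_point (0, 0) = (0, 0)" by (simp add: complex_point_def)
  ultimately show ?thesis
    using tendsto_at_iff_tendsto_nhds[of complex_point "(0, 0)"] by (simp add: isCont_def)
qed

text \<open>
  The estimate forces the leading homogeneous part of degree less than \<open>k\<close> to vanish at all real
  points, by scaling; by the identity theorem it vanishes, and the order of the germ increases.
\<close>

lemma ord_ge_from_real_bigo:
  assumes h: "holomorphic_at_origin h"
    and "(\<lambda>v. h (complex_point v)) \<in> O[nhds (0, 0)](\<lambda>v. of_real (norm v ^ k))"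
  shows "ord_ge k h"
  using assms(2)
proof (induction k)
  case 0
  then show ?case using h by simp
next
  case (Suc k)
  have "(\<lambda>v :: real \<times> real. of_real (norm v ^ Suc k) :: complex) \<in> O[nhds (0, 0)](\<lambda>v. of_real (norm v ^ k))"
  proof (intro bigoI[of _ 1])
    have "\<forall>\<^sub>F v :: real \<times> real in nhds (0, 0). v \<in> ball (0, 0) 1"
      by (intro eventually_nhds_in_open) auto
    then show "\<forall>\<^sub>F v :: real \<times> real in nhds (0, 0). cmod (of_real (norm v ^ Suc k)) \<le> 1 * cmod (of_real (norm v ^ k))"
    proof eventually_elim
      case (elim v)
      then have "norm v ^ Suc k \<le> norm v ^ k"
        by (intro power_decreasing) (auto simp: zero_prod_def[symmetric])
      then show ?case by (simp add: norm_mult norm_power)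
    qed
  qed
  with Suc.prems have "(\<lambda>v. h (complex_point v)) \<in> O[nhds (0, 0)](\<lambda>v. of_real (norm v ^ k))"
    by (rule landau_o.big_trans)
  from ord_ge_leading_part[OF Suc.IH[OF this]] obtain q where q: "holomorphic_at_origin q"
    "\<And>t p. q (t *\<^sub>R p) = of_real t ^ k * q p" "ord_ge (Suc k) (\<lambda>p. h p - q p)" by blast
  have "(\<lambda>v. h (complex_point v) - q (complex_point v)) \<in> O[nhds (0, 0)](\<lambda>v. of_real (norm v ^ Suc k))"
    using landau_o.big.compose[OF ord_ge_bigo[OF q(3)] filterlim_complex_point] by simp
  from sum_in_bigo(2)[OF Suc.prems this]
  have "(\<lambda>v. q (complex_point v)) \<in> O[nhds (0, 0)](\<lambda>v. of_real (norm v ^ Suc k) :: complex)" by simp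
  then obtain C where C: "\<forall>\<^sub>F v in nhds (0, 0). norm (q (complex_point v)) \<le> C * norm (of_real (norm v ^ Suc k) :: complex)"
    by (elim landau_o.bigE) auto
  have q0: "q (complex_point v) = 0" for v
  proof -
    \<comment> \<open>Compare both sides along the ray through \<open>v\<close>: homogeneity cancels \<open>t\<^sup>k\<close> and leaves a factor \<open>t\<close>.\<close>
    have lim: "((\<lambda>t. t *\<^sub>R v) \<longlongrightarrow> (0, 0)) (at_right (0::real))"
      by (auto intro!: tendsto_eq_intros simp: zero_prod_def)
    have "\<forall>\<^sub>F t in at_right 0. norm (q (complex_point v)) \<le> t * (C * norm v ^ Suc k)"
      using eventually_compose_filterlim[OF C lim] eventually_at_right_less[of 0]
    proof eventually_elim
      case (elim t)
      have "complex_point (t *\<^sub>R v) = t *\<^sub>R complex_point v"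
        by (simp add: complex_point_def scaleR_prod_def scaleR_conv_of_real)
      with elim have "t ^ k * norm (q (complex_point v)) \<le> t ^ k * (t * (C * norm v ^ Suc k))"
        by (simp add: q(2) norm_mult norm_power power_mult_distrib algebra_simps)
      with elim(2) show ?case by simp
    qed
    moreover have "((\<lambda>t. t * (C * norm v ^ Suc k)) \<longlongrightarrow> 0) (at_right 0)"
      by (auto intro!: tendsto_eq_intros)
    ultimately have "norm (q (complex_point v)) \<le> 0"
      by (intro tendsto_lowerbound[of _ 0 "at_right 0"]) auto
    then show ?thesis by simp
  qed
  have "\<forall>\<^sub>F p in nhds (0, 0). q p = 0"
    by (rule identity_real_plane[OF q(1)]) (use q0 in \<open>auto simp: complex_point_def intro!: always_eventually\<close>)
  then have "\<forall>\<^sub>F p in nhds (0, 0). h p - q p = h p" by eventually_elim simp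
  with q(3) show ?case by (rule ord_ge_cong)
qed

text \<open>
  Taylor expansions with remainder may be differentiated term by term.
\<close>

lemma ord_ge_cderiv_fst_diff:
  assumes "holomorphic_at_origin F" "holomorphic_at_origin T" "ord_ge (Suc k) (\<lambda>p. F p - T p)"
    and "\<And>z w. ((\<lambda>s. T (s, w)) has_field_derivative T' (z, w)) (at z)"
  shows "ord_ge k (\<lambda>p. cderiv_fst F p - T' p)"
proof (rule ord_ge_cong[OF ord_ge_cderiv_fst[OF assms(3)]])
  obtain r where r: "r > 0" "hol_polydisc r F"
    using assms(1) by (auto simp: holomorphic_at_origin_iff_polydisc)
  have "cderiv_fst (\<lambda>p. F p - T p) p = cderiv_fst F p - T' p" if p: "p \<in> polydisc r" for p
  proof -
    obtain z w where zw: "p = (z, w)" "norm z < r" "norm w < r" using p by (cases p) auto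
    have "((\<lambda>s. F (s, w) - T (s, w)) has_field_derivative cderiv_fst F (z, w) - T' (z, w)) (at z)"
      by (intro DERIV_diff hol_polydisc_has_deriv_fst[OF r(2) zw(2,3)] assms(4))
    from DERIV_imp_deriv[OF this] show ?thesis by (simp add: zw(1) cderiv_fst_def)
  qed
  with r(1) show "\<forall>\<^sub>F p in nhds (0, 0). cderiv_fst (\<lambda>p. F p - T p) p = cderiv_fst F p - T' p"
    unfolding eventually_nhds_origin_polydisc by blast
qed

lemma ord_ge_cderiv_snd_diff:
  assumes "holomorphic_at_origin F" "holomorphic_at_origin T" "ord_ge (Suc k) (\<lambda>p. F p - T p)"
    and "\<And>z w. ((\<lambda>s. T (z, s)) has_field_derivative T' (z, w)) (at w)"
  shows "ord_ge k (\<lambda>p. cderiv_snd F p - T' p)"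
proof -
  have "ord_ge k (\<lambda>p. cderiv_fst (F \<circ> prod.swap) p - (T' \<circ> prod.swap) p)"
  proof (rule ord_ge_cderiv_fst_diff[where T = "T \<circ> prod.swap"])
    show "ord_ge (Suc k) (\<lambda>p. (F \<circ> prod.swap) p - (T \<circ> prod.swap) p)"
      using ord_ge_swap[OF assms(3)] unfolding o_def .
    show "((\<lambda>s. (T \<circ> prod.swap) (s, w)) has_field_derivative (T' \<circ> prod.swap) (z, w)) (at z)" for z w
      using assms(4)[of w z] by simp
  qed (intro holomorphic_at_origin_swap assms(1,2))+
  from ord_ge_swap[OF this] show ?thesis by (simp add: cderiv_snd_swap o_def)
qed

text \<open>
  The third power of the maximal ideal lies in \<open>\<langle>x, y\<rangle> \<langle>x\<^sup>2, y\<rangle>\<close>, because \<open>x\<^sup>3 = x x\<^sup>2\<close> and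
  every other cubic monomial is \<open>y\<close> times a quadratic one.
\<close>

lemma ord_ge_3E:
  assumes "ord_ge 3 e"
  obtains u v where "ord_ge 1 u" "ord_ge 1 v" "\<forall>\<^sub>F p in nhds (0, 0). e p = u p * fst p ^ 2 + v p * snd p"
proof -
  obtain g h where gh: "ord_ge (Suc 1) g" "ord_ge (Suc 1) h"
    "\<forall>\<^sub>F p in nhds (0, 0). e p = fst p * g p + snd p * h p"
    using assms[unfolded numeral_3_eq_3 One_nat_def[symmetric]] by (rule ord_ge_SucE)
  obtain u v where uv: "ord_ge 1 u" "ord_ge 1 v" "\<forall>\<^sub>F p in nhds (0, 0). g p = fst p * u p + snd p * v p"
    using gh(1) by (rule ord_ge_SucE)
  have "ord_ge 1 (\<lambda>p. fst p * v p + h p)"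
    using uv(2) ord_ge_SucD[OF gh(2)]
    by (intro ord_ge_add ord_ge_holomorphic_mult holomorphic_at_origin_fst)
  moreover have "\<forall>\<^sub>F p in nhds (0, 0). e p = u p * fst p ^ 2 + (fst p * v p + h p) * snd p"
    using gh(3) uv(3) by eventually_elim (simp add: algebra_simps power2_eq_square)
  ultimately show thesis using that uv(1) by blast
qed

section \<open>Ideals and quotients of the ring of germs\<close>

lemma germ_of_conv: "germ_of h = {k. \<forall>\<^sub>F p in nhds (0, 0). k p = h p}"
proof (rule Set.set_eqI)
  fix k
  have "k \<in> germ_of h \<longleftrightarrow> (\<exists>n\<in>null_functions. k = (\<lambda>z. n z + h z))"
    by (simp add: germ_of_def a_r_coset_def' hol_ring_def)
  also have "\<dots> \<longleftrightarrow> (\<forall>\<^sub>F p in nhds (0, 0). k p = h p)"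
  proof
    assume "\<forall>\<^sub>F p in nhds (0, 0). k p = h p"
    then show "\<exists>n\<in>null_functions. k = (\<lambda>z. n z + h z)"
      by (intro bexI[of _ "\<lambda>z. k z - h z"]) (auto simp: null_functions_def elim: eventually_mono)
  qed (auto simp: null_functions_def elim: eventually_mono)
  finally show "k \<in> germ_of h \<longleftrightarrow> k \<in> {k. \<forall>\<^sub>F p in nhds (0, 0). k p = h p}" by simp
qed

lemma germ_of_eq_iff: "germ_of g = germ_of h \<longleftrightarrow> (\<forall>\<^sub>F p in nhds (0, 0). g p = h p)"
proof
  assume "germ_of g = germ_of h"
  moreover have "g \<in> germ_of g" by (simp add: germ_of_conv)
  ultimately show "\<forall>\<^sub>F p in nhds (0, 0). g p = h p" by (simp add: germ_of_conv)
next
  assume *: "\<forall>\<^sub>F p in nhds (0, 0). g p = h p"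
  have "(\<forall>\<^sub>F p in nhds (0, 0). k p = g p) \<longleftrightarrow> (\<forall>\<^sub>F p in nhds (0, 0). k p = h p)" for k
    by (rule eventually_subst) (use * in \<open>auto elim: eventually_mono\<close>)
  then show "germ_of g = germ_of h" by (simp add: germ_of_conv)
qed

lemma carrier_hol_ring [simp]: "h \<in> carrier hol_ring \<longleftrightarrow> holomorphic_at_origin h"
  by (simp add: hol_ring_def)

lemma germ_of_ring_hom: "ring_hom_cring hol_ring O2 germ_of"
proof -
  have "germ_of = (+>\<^bsub>hol_ring\<^esub>) null_functions"
    by (rule ext) (simp add: germ_of_def)
  then show ?thesis
    unfolding O2_def using ideal.rcos_ring_hom_cring[OF ideal_null_functions cring_hol_ring] by simp
qed

lemma carrier_O2: "carrier O2 = germ_of ` {h. holomorphic_at_origin h}"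
  by (auto simp: O2_def FactRing_def A_RCOSETS_def' germ_of_def)

lemma germ_of_closed [simp]: "holomorphic_at_origin h \<Longrightarrow> germ_of h \<in> carrier O2"
  by (simp add: carrier_O2)

lemma germ_of_mult:
  "holomorphic_at_origin g \<Longrightarrow> holomorphic_at_origin h \<Longrightarrow>
     germ_of g \<otimes>\<^bsub>O2\<^esub> germ_of h = germ_of (\<lambda>p. g p * h p)"
  using ring_hom_mult[OF ring_hom_cring.homh[OF germ_of_ring_hom], of g h] by (simp add: hol_ring_def)

lemma germ_of_add:
  "holomorphic_at_origin g \<Longrightarrow> holomorphic_at_origin h \<Longrightarrow>
     germ_of g \<oplus>\<^bsub>O2\<^esub> germ_of h = germ_of (\<lambda>p. g p + h p)"
  using ring_hom_add[OF ring_hom_cring.homh[OF germ_of_ring_hom], of g h] by (simp add: hol_ring_def)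

text \<open>
  Two holomorphic extensions have the same germ by the identity theorem, so the definite description
  denotes the germ of any extension at hand.
\<close>

lemma complexify_eq:
  assumes h: "holomorphic_at_origin h"
    and real: "\<forall>\<^sub>F (x, y) in nhds (0, 0). h (of_real x, of_real y) = of_real (g (x, y))"
  shows "complexify g = germ_of h"
  unfolding complexify_def
proof (rule the_equality)
  show "\<exists>h'. holomorphic_at_origin h' \<and> germ_of h = germ_of h' \<and>
      (\<forall>\<^sub>F (x, y) in nhds (0, 0). h' (of_real x, of_real y) = of_real (g (x, y)))"
    using h real by blast
next
  fix \<phi> assume "\<exists>h'. holomorphic_at_origin h' \<and> \<phi> = germ_of h' \<and>
      (\<forall>\<^sub>F (x, y) in nhds (0, 0). h' (of_real x, of_real y) = of_real (g (x, y)))"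
  then obtain h' where h': "holomorphic_at_origin h'" "\<phi> = germ_of h'"
      "\<forall>\<^sub>F (x, y) in nhds (0, 0). h' (of_real x, of_real y) = of_real (g (x, y))" by blast
  have "\<forall>\<^sub>F p in nhds (0, 0). h' p - h p = 0"
  proof (rule identity_real_plane)
    show "\<forall>\<^sub>F (x, y) in nhds (0, 0). h' (of_real x, of_real y) - h (of_real x, of_real y) = 0"
      using h'(3) real by eventually_elim auto
  qed (intro hol_intros h h'(1))
  then show "\<phi> = germ_of h" by (simp add: h'(2) germ_of_eq_iff)
qed

text \<open>
  The combinations of the generators form an ideal, and every ideal with these generators contains
  them.
\<close>

lemma Idl_germs_eq:
  assumes b: "holomorphic_at_origin b" and c: "holomorphic_at_origin c"
  shows "Idl\<^bsub>O2\<^esub> {germ_of b, germ_of c} =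
    {germ_of (\<lambda>p. u p * b p + v p * c p) | u v. holomorphic_at_origin u \<and> holomorphic_at_origin v}"
proof -
  define J where "J = {germ_of (\<lambda>p. u p * b p + v p * c p) | u v. holomorphic_at_origin u \<and> holomorphic_at_origin v}"
  interpret cring O2 by (rule cring_O2)
  note [simp] = germ_of_mult germ_of_add holomorphic_at_origin_mult holomorphic_at_origin_add b c
  have J: "germ_of (\<lambda>p. u p * b p + v p * c p) \<in> J"
    if "holomorphic_at_origin u" "holomorphic_at_origin v" for u v
    unfolding J_def using that by blast
  have JE: thesis if "\<alpha> \<in> J" "\<And>u v. holomorphic_at_origin u \<Longrightarrow> holomorphic_at_origin v \<Longrightarrow>
      \<alpha> = germ_of (\<lambda>p. u p * b p + v p * c p) \<Longrightarrow> thesis" for \<alpha> thesis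
    using that unfolding J_def by blast
  have "ideal J O2"
  proof (rule idealI[OF ring_axioms])
    show "subgroup J (add_monoid O2)"
    proof (rule add.subgroupI)
      show "J \<subseteq> carrier O2" by (auto elim!: JE)
      show "J \<noteq> {}" using J[OF holomorphic_at_origin_const holomorphic_at_origin_const] by blast
    next
      fix \<alpha> assume "\<alpha> \<in> J"
      then obtain u v where uv: "holomorphic_at_origin u" "holomorphic_at_origin v"
        "\<alpha> = germ_of (\<lambda>p. u p * b p + v p * c p)" by (rule JE)
      have "\<ominus>\<^bsub>O2\<^esub> \<alpha> = germ_of (\<lambda>p. (- u p) * b p + (- v p) * c p)"
      proof (rule minus_equality)
        have "\<zero>\<^bsub>O2\<^esub> = germ_of (\<lambda>p. 0)"
          using ring_hom_cring.hom_zero[OF germ_of_ring_hom] by (simp add: hol_ring_def)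
        then show "germ_of (\<lambda>p. (- u p) * b p + (- v p) * c p) \<oplus>\<^bsub>O2\<^esub> \<alpha> = \<zero>\<^bsub>O2\<^esub>"
          using uv by (simp add: holomorphic_at_origin_uminus holomorphic_at_origin_diff)
      qed (use uv in \<open>simp_all add: holomorphic_at_origin_uminus holomorphic_at_origin_diff\<close>)
      also have "\<dots> \<in> J" using uv by (intro J holomorphic_at_origin_uminus)
      finally show "\<ominus>\<^bsub>O2\<^esub> \<alpha> \<in> J" .
    next
      fix \<alpha> \<beta> assume \<alpha>: "\<alpha> \<in> J" and \<beta>: "\<beta> \<in> J"
      obtain u v where uv1: "holomorphic_at_origin u" "holomorphic_at_origin v"
        "\<alpha> = germ_of (\<lambda>p. u p * b p + v p * c p)" using \<alpha> by (rule JE)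
      obtain u' v' where uv2: "holomorphic_at_origin u'" "holomorphic_at_origin v'"
        "\<beta> = germ_of (\<lambda>p. u' p * b p + v' p * c p)" using \<beta> by (rule JE)
      note uv = uv1 uv2
      have "\<alpha> \<oplus>\<^bsub>O2\<^esub> \<beta> = germ_of (\<lambda>p. (u p + u' p) * b p + (v p + v' p) * c p)"
        using uv by (simp add: algebra_simps)
      also have "\<dots> \<in> J" using uv by (intro J holomorphic_at_origin_add)
      finally show "\<alpha> \<oplus>\<^bsub>O2\<^esub> \<beta> \<in> J" .
    qed
  next
    fix \<alpha> \<gamma> assume \<alpha>: "\<alpha> \<in> J" and "\<gamma> \<in> carrier O2"
    then obtain w where w: "holomorphic_at_origin w" "\<gamma> = germ_of w"
      unfolding carrier_O2 by blast
    obtain u v where uv1: "holomorphic_at_origin u" "holomorphic_at_origin v"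
      "\<alpha> = germ_of (\<lambda>p. u p * b p + v p * c p)" using \<alpha> by (rule JE)
    note uv = uv1 w
    have "\<gamma> \<otimes>\<^bsub>O2\<^esub> \<alpha> = germ_of (\<lambda>p. (w p * u p) * b p + (w p * v p) * c p)"
      using uv by (simp add: algebra_simps)
    also have "\<dots> \<in> J" using uv by (intro J holomorphic_at_origin_mult)
    finally show "\<gamma> \<otimes>\<^bsub>O2\<^esub> \<alpha> \<in> J" .
    then show "\<alpha> \<otimes>\<^bsub>O2\<^esub> \<gamma> \<in> J" using uv by (simp add: m_comm)
  qed
  moreover have "{germ_of b, germ_of c} \<subseteq> J"
    using J[of "\<lambda>_. 1" "\<lambda>_. 0"] J[of "\<lambda>_. 0" "\<lambda>_. 1"] by (simp add: holomorphic_at_origin_const)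
  ultimately have "Idl\<^bsub>O2\<^esub> {germ_of b, germ_of c} \<subseteq> J" by (rule genideal_minimal)
  moreover have "J \<subseteq> Idl\<^bsub>O2\<^esub> {germ_of b, germ_of c}"
  proof
    fix \<alpha> assume "\<alpha> \<in> J"
    then obtain u v where uv: "holomorphic_at_origin u" "holomorphic_at_origin v"
      "\<alpha> = germ_of (\<lambda>p. u p * b p + v p * c p)" by (rule JE)
    interpret I: ideal "Idl\<^bsub>O2\<^esub> {germ_of b, germ_of c}" O2 by (rule genideal_ideal) simp
    have "{germ_of b, germ_of c} \<subseteq> Idl\<^bsub>O2\<^esub> {germ_of b, germ_of c}" by (rule genideal_self) simp
    then have "germ_of u \<otimes>\<^bsub>O2\<^esub> germ_of b \<oplus>\<^bsub>O2\<^esub> germ_of v \<otimes>\<^bsub>O2\<^esub> germ_of c \<in> Idl\<^bsub>O2\<^esub> {germ_of b, germ_of c}"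
      using uv by (intro I.a_closed I.I_l_closed) auto
    then show "\<alpha> \<in> Idl\<^bsub>O2\<^esub> {germ_of b, germ_of c}"
      using uv by simp
  qed
  ultimately show ?thesis unfolding J_def[symmetric] by (rule equalityI)
qed

lemma mem_Idl_germs:
  assumes "holomorphic_at_origin b" "holomorphic_at_origin c"
  shows "germ_of h \<in> Idl\<^bsub>O2\<^esub> {germ_of b, germ_of c} \<longleftrightarrow>
    (\<exists>u v. holomorphic_at_origin u \<and> holomorphic_at_origin v \<and>
       (\<forall>\<^sub>F p in nhds (0, 0). h p = u p * b p + v p * c p))"
  unfolding Idl_germs_eq[OF assms] by (auto simp: germ_of_eq_iff)

text \<open>
  Cramer's rule: the determinant is a unit near the origin, so \<open>g\<^sub>1\<close> and \<open>g\<^sub>2\<close> are in turn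
  combinations of \<open>b\<close> and \<open>c\<close>.
\<close>

lemma Idl_germs_unimodular:
  assumes hol: "holomorphic_at_origin b" "holomorphic_at_origin c" "holomorphic_at_origin g1" "holomorphic_at_origin g2"
    "holomorphic_at_origin p1" "holomorphic_at_origin q1" "holomorphic_at_origin p2" "holomorphic_at_origin q2"
    and b: "\<forall>\<^sub>F p in nhds (0, 0). b p = p1 p * g1 p + q1 p * g2 p"
    and c: "\<forall>\<^sub>F p in nhds (0, 0). c p = p2 p * g1 p + q2 p * g2 p"
    and det: "p1 (0, 0) * q2 (0, 0) - q1 (0, 0) * p2 (0, 0) \<noteq> 0"
  shows "Idl\<^bsub>O2\<^esub> {germ_of b, germ_of c} = Idl\<^bsub>O2\<^esub> {germ_of g1, germ_of g2}"
proof -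
  interpret cring O2 by (rule cring_O2)
  define D where "D = (\<lambda>p. p1 p * q2 p - q1 p * p2 p)"
  have D: "holomorphic_at_origin D" unfolding D_def by (intro hol_intros hol)
  have iD: "holomorphic_at_origin (\<lambda>p. inverse (D p))"
    by (rule holomorphic_at_origin_inverse[OF D]) (use det in \<open>simp add: D_def\<close>)
  have "(D \<longlongrightarrow> D (0, 0)) (nhds (0, 0))"
    using holomorphic_at_origin_isCont[OF D] by (simp add: isCont_def tendsto_at_iff_tendsto_nhds)
  then have "\<forall>\<^sub>F p in nhds (0, 0). D p \<noteq> 0"
    by (rule tendsto_imp_eventually_ne) (use det in \<open>simp add: D_def\<close>)
  with b c have g1: "\<forall>\<^sub>F p in nhds (0, 0). g1 p = (inverse (D p) * q2 p) * b p + (- (inverse (D p) * q1 p)) * c p"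
  proof eventually_elim
    case (elim p)
    have "q2 p * b p - q1 p * c p = D p * g1 p"
      unfolding elim(1,2) D_def by (simp add: algebra_simps)
    then have "g1 p = inverse (D p) * (q2 p * b p - q1 p * c p)" using elim(3) by simp
    then show ?case by (simp add: algebra_simps)
  qed
  from \<open>\<forall>\<^sub>F p in nhds (0, 0). D p \<noteq> 0\<close> b c
  have g2: "\<forall>\<^sub>F p in nhds (0, 0). g2 p = (- (inverse (D p) * p2 p)) * b p + (inverse (D p) * p1 p) * c p"
  proof eventually_elim
    case (elim p)
    have "p1 p * c p - p2 p * b p = D p * g2 p"
      unfolding elim(2,3) D_def by (simp add: algebra_simps)
    then have "g2 p = inverse (D p) * (p1 p * c p - p2 p * b p)" using elim(1) by simp
    then show ?case by (simp add: algebra_simps)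
  qed
  have hols: "holomorphic_at_origin (\<lambda>p. inverse (D p) * q2 p)" "holomorphic_at_origin (\<lambda>p. - (inverse (D p) * q1 p))"
    "holomorphic_at_origin (\<lambda>p. - (inverse (D p) * p2 p))" "holomorphic_at_origin (\<lambda>p. inverse (D p) * p1 p)"
    by (intro hol_intros hol iD)+
  show ?thesis
  proof (rule equalityI)
    have "germ_of b \<in> Idl\<^bsub>O2\<^esub> {germ_of g1, germ_of g2}" "germ_of c \<in> Idl\<^bsub>O2\<^esub> {germ_of g1, germ_of g2}"
      unfolding mem_Idl_germs[OF hol(3,4)] using b c hol by blast+
    then show "Idl\<^bsub>O2\<^esub> {germ_of b, germ_of c} \<subseteq> Idl\<^bsub>O2\<^esub> {germ_of g1, germ_of g2}"
      using hol by (intro genideal_minimal genideal_ideal) auto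
    have "germ_of g1 \<in> Idl\<^bsub>O2\<^esub> {germ_of b, germ_of c}" "germ_of g2 \<in> Idl\<^bsub>O2\<^esub> {germ_of b, germ_of c}"
      unfolding mem_Idl_germs[OF hol(1,2)] using g1 g2 hols by blast+
    then show "Idl\<^bsub>O2\<^esub> {germ_of g1, germ_of g2} \<subseteq> Idl\<^bsub>O2\<^esub> {germ_of b, germ_of c}"
      using hol by (intro genideal_minimal genideal_ideal) auto
  qed
qed

text \<open>
  The complex numbers as a ring record, so that the constants in a quotient of the ring of germs can
  be recognised as a subfield, namely as the image of a field.
\<close>

definition complex_field :: "complex ring" where
  "complex_field = \<lparr>carrier = UNIV, mult = (*), one = 1, zero = 0, add = (+)\<rparr>"

lemma field_complex_field: "field complex_field"
proof -
  have "cring complex_field"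
  proof (rule cringI)
    show "abelian_group complex_field"
    proof (rule abelian_groupI)
      fix z assume "z \<in> carrier complex_field"
      show "\<exists>w\<in>carrier complex_field. w \<oplus>\<^bsub>complex_field\<^esub> z = \<zero>\<^bsub>complex_field\<^esub>"
        by (intro bexI[of _ "- z"]) (simp_all add: complex_field_def)
    qed (simp_all add: complex_field_def)
    show "comm_monoid complex_field"
      by (rule comm_monoidI) (simp_all add: complex_field_def)
  qed (simp add: complex_field_def algebra_simps)
  then show ?thesis
  proof (rule cring.cring_fieldI2)
    fix z assume "z \<noteq> \<zero>\<^bsub>complex_field\<^esub>"
    then show "\<exists>w\<in>carrier complex_field. z \<otimes>\<^bsub>complex_field\<^esub> w = \<one>\<^bsub>complex_field\<^esub>"
      by (intro bexI[of _ "inverse z"]) (simp_all add: complex_field_def)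
  qed (simp add: complex_field_def)
qed

text \<open>
  On the line \<open>w = 0\<close> the equation would read \<open>z\<^sup>n = z\<^sup>n k (z)\<close> with \<open>k (0) = 0\<close>.
\<close>

lemma fst_power_unique:
  assumes "n < N" "holomorphic_at_origin g" "holomorphic_at_origin u" "holomorphic_at_origin v"
  shows "\<not> (\<forall>\<^sub>F p in nhds (0, 0). fst p ^ n - fst p ^ Suc n * g p = u p * fst p ^ N + v p * snd p)"
proof
  assume ev: "\<forall>\<^sub>F p in nhds (0, 0). fst p ^ n - fst p ^ Suc n * g p = u p * fst p ^ N + v p * snd p"
  define k where "k = (\<lambda>p. fst p * (g p + u p * fst p ^ (N - Suc n)))"
  have "holomorphic_at_origin k" unfolding k_def by (intro hol_intros assms)
  then have "(k \<longlongrightarrow> k (0, 0)) (nhds (0, 0))"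
    using holomorphic_at_origin_isCont by (simp add: isCont_def tendsto_at_iff_tendsto_nhds)
  moreover have lim: "((\<lambda>z :: complex. (z, 0 :: complex)) \<longlongrightarrow> (0, 0)) (at 0)"
    by (auto intro!: tendsto_eq_intros)
  ultimately have "((\<lambda>z. k (z, 0)) \<longlongrightarrow> k (0, 0)) (at 0)"
    by (rule filterlim_compose)
  moreover have "\<forall>\<^sub>F z in at 0. k (z, 0) = 1"
    using eventually_compose_filterlim[OF ev lim] eventually_neq_at_within[of 0 0 UNIV]
  proof eventually_elim
    case (elim z)
    have "z ^ N = z ^ Suc n * z ^ (N - Suc n)"
      unfolding power_add[symmetric] using assms(1) by simp
    with elim(1) have "z ^ n * k (z, 0) = z ^ n * 1"
      by (simp add: k_def algebra_simps)
    with elim(2) show ?case by simp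
  qed
  then have "((\<lambda>z. k (z, 0)) \<longlongrightarrow> 1) (at 0)" by (rule tendsto_eventually)
  ultimately have "k (0, 0) = 1" by (intro tendsto_unique) auto
  then show False by (simp add: k_def)
qed

text \<open>
  The subspaces \<open>E j\<close> generated by \<open>x\<close> to the power \<open>N - j\<close> form a complete flag of the quotient.
  Each step adds one line because \<open>x\<^sup>n g = g(0) x\<^sup>n + x\<^sup>n\<^sup>+\<^sup>1 g\<^sub>1 + y (\<dots>)\<close> by Hadamard's lemma, and the
  step is proper by \<open>fst_power_unique\<close>.
\<close>

lemma quotient_dim_fst_power_snd:
  assumes N: "N > 0"
  shows "quotient_dim (Idl\<^bsub>O2\<^esub> {germ_of (\<lambda>p. fst p ^ N), germ_of snd}) = enat N"
proof -
  define I where "I = Idl\<^bsub>O2\<^esub> {germ_of (\<lambda>p. fst p ^ N), germ_of snd}"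
  define \<phi> where "\<phi> = (\<lambda>h. I +>\<^bsub>O2\<^esub> germ_of h)"
  let ?Q = "O2 Quot I"
  have xN: "holomorphic_at_origin (\<lambda>p. fst p ^ N)" by (intro hol_intros)
  note mem_I = mem_Idl_germs[OF xN holomorphic_at_origin_snd, folded I_def]
  interpret O2: cring O2 by (rule cring_O2)
  interpret I: ideal I O2
    unfolding I_def by (rule O2.genideal_ideal) (simp add: xN holomorphic_at_origin_snd)
  interpret Q: cring ?Q by (rule I.quotient_is_cring[OF cring_O2])
  have "ring_hom_cring O2 ?Q ((+>\<^bsub>O2\<^esub>) I)" by (rule I.rcos_ring_hom_cring[OF cring_O2])
  then have hom: "(+>\<^bsub>O2\<^esub>) I \<in> ring_hom O2 ?Q" by (rule ring_hom_cring.homh)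
  have germ: "germ_of \<in> ring_hom hol_ring O2" using germ_of_ring_hom by (rule ring_hom_cring.homh)
  have \<phi>_mult: "\<phi> g \<otimes>\<^bsub>?Q\<^esub> \<phi> h = \<phi> (\<lambda>p. g p * h p)"
    if "holomorphic_at_origin g" "holomorphic_at_origin h" for g h
    using ring_hom_mult[OF hom, of "germ_of g" "germ_of h"] that by (simp add: \<phi>_def germ_of_mult)
  have \<phi>_add: "\<phi> g \<oplus>\<^bsub>?Q\<^esub> \<phi> h = \<phi> (\<lambda>p. g p + h p)"
    if "holomorphic_at_origin g" "holomorphic_at_origin h" for g h
    using ring_hom_add[OF hom, of "germ_of g" "germ_of h"] that by (simp add: \<phi>_def germ_of_add)
  have carrier_Q: "carrier ?Q = \<phi> ` {h. holomorphic_at_origin h}"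
    by (auto simp: FactRing_def A_RCOSETS_def' carrier_O2 \<phi>_def)
  have \<phi>_eq: "\<phi> g = \<phi> h \<longleftrightarrow> germ_of (\<lambda>p. g p - h p) \<in> I"
    if gh: "holomorphic_at_origin g" "holomorphic_at_origin h" for g h
  proof -
    have "germ_of g = germ_of (\<lambda>p. g p - h p) \<oplus>\<^bsub>O2\<^esub> germ_of h"
      using gh by (simp add: germ_of_add holomorphic_at_origin_diff)
    then have "germ_of (\<lambda>p. g p - h p) = germ_of g \<ominus>\<^bsub>O2\<^esub> germ_of h"
      using gh by (simp add: O2.minus_eq O2.a_assoc O2.r_neg holomorphic_at_origin_diff)
    then show ?thesis
      using O2.quotient_eq_iff_same_a_r_cos[OF I.ideal_axioms, of "germ_of g" "germ_of h"] gh
      by (simp add: \<phi>_def)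
  qed
  have zero_Q: "\<zero>\<^bsub>?Q\<^esub> = \<phi> (\<lambda>_. 0)"
  proof -
    have "\<phi> (\<lambda>_. 0) \<oplus>\<^bsub>?Q\<^esub> \<phi> (\<lambda>_. 0) = \<phi> (\<lambda>_. 0)"
      by (simp add: \<phi>_add holomorphic_at_origin_const)
    moreover have "\<phi> (\<lambda>_. 0) \<in> carrier ?Q" by (auto simp: carrier_Q holomorphic_at_origin_const)
    ultimately show ?thesis using Q.add.r_cancel_one[of "\<phi> (\<lambda>_. 0)" "\<phi> (\<lambda>_. 0)"] by simp
  qed
  have one_Q: "\<one>\<^bsub>?Q\<^esub> = \<phi> (\<lambda>_. 1)"
    using ring_hom_one[OF hom] ring_hom_one[OF germ] by (simp add: \<phi>_def hol_ring_def)
  have pow_notin: "\<phi> (\<lambda>p. fst p ^ n) \<noteq> \<phi> (\<lambda>p. fst p ^ Suc n * g p)"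
    if "n < N" "holomorphic_at_origin g" for n g
    using fst_power_unique[OF that] that
    by (subst \<phi>_eq) (auto simp: mem_I intro!: hol_intros)
  define K where "K = constants_mod I"
  have K: "K = range (\<lambda>k. \<phi> (\<lambda>_. k))"
    by (simp add: K_def constants_mod_def \<phi>_def)
  have "subfield K ?Q"
  proof -
    interpret C: field complex_field by (rule field_complex_field)
    have "ring_hom_ring complex_field ?Q (\<lambda>k. \<phi> (\<lambda>_. k))"
      by (rule ring_hom_ringI[OF C.ring_axioms Q.ring_axioms])
         (auto simp: complex_field_def carrier_Q \<phi>_mult \<phi>_add one_Q holomorphic_at_origin_const)
    note img = ring_hom_ring.img_is_subfield(2)[OF this C.carrier_is_subfield]
    moreover have "\<one>\<^bsub>?Q\<^esub> \<noteq> \<zero>\<^bsub>?Q\<^esub>"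
      using pow_notin[OF N holomorphic_at_origin_const[of 0]] by (simp add: one_Q zero_Q)
    ultimately have "subfield ((\<lambda>k. \<phi> (\<lambda>_. k)) ` carrier complex_field) ?Q"
      by blast
    then show ?thesis by (simp add: K complex_field_def)
  qed
  define E where "E = (\<lambda>j. (\<lambda>g. \<phi> (\<lambda>p. fst p ^ (N - j) * g p)) ` {g. holomorphic_at_origin g})"
  have dim: "Q.dimension j K (E j)" if "j \<le> N" for j
    using that
  proof (induction j)
    case 0
    have "\<phi> (\<lambda>p. fst p ^ N * g p) = \<zero>\<^bsub>?Q\<^esub>" if g: "holomorphic_at_origin g" for g
    proof -
      have "\<exists>u v. holomorphic_at_origin u \<and> holomorphic_at_origin v \<and>
          (\<forall>\<^sub>F p in nhds (0, 0). fst p ^ N * g p - 0 = u p * fst p ^ N + v p * snd p)"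
        by (intro exI[of _ g] exI[of _ "\<lambda>_. 0"]) (simp add: g holomorphic_at_origin_const mult.commute)
      then show ?thesis
        unfolding zero_Q by (subst \<phi>_eq) (auto simp: mem_I g intro!: hol_intros)
    qed
    then have "E 0 = {\<zero>\<^bsub>?Q\<^esub>}"
      using holomorphic_at_origin_const[of 0] by (auto simp: E_def image_iff)
    then show ?case by simp
  next
    case (Suc j)
    define n where "n = N - Suc j"
    have n: "n < N" "N - j = Suc n" using Suc.prems by (auto simp: n_def)
    have hol_n: "holomorphic_at_origin (\<lambda>p. fst p ^ n)" by (intro hol_intros)
    have "E (Suc j) = Q.line_extension K (\<phi> (\<lambda>p. fst p ^ n)) (E j)"
    proof (rule Set.set_eqI)
      fix y
      have sum: "\<phi> (\<lambda>_. k) \<otimes>\<^bsub>?Q\<^esub> \<phi> (\<lambda>p. fst p ^ n) \<oplus>\<^bsub>?Q\<^esub> \<phi> (\<lambda>p. fst p ^ Suc n * g p) =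
          \<phi> (\<lambda>p. k * fst p ^ n + fst p ^ Suc n * g p)" if g: "holomorphic_at_origin g" for k g
      proof -
        have "holomorphic_at_origin (\<lambda>p. k * fst p ^ n)" "holomorphic_at_origin (\<lambda>p. fst p ^ Suc n * g p)"
          by (intro hol_intros g)+
        then show ?thesis by (simp only: \<phi>_mult \<phi>_add hol_n holomorphic_at_origin_const)
      qed
      have "y \<in> Q.line_extension K (\<phi> (\<lambda>p. fst p ^ n)) (E j) \<longleftrightarrow>
         (\<exists>k g. holomorphic_at_origin g \<and>
            y = \<phi> (\<lambda>_. k) \<otimes>\<^bsub>?Q\<^esub> \<phi> (\<lambda>p. fst p ^ n) \<oplus>\<^bsub>?Q\<^esub> \<phi> (\<lambda>p. fst p ^ Suc n * g p))"
        unfolding Q.line_extension_mem_iff K E_def n(2) by blast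
      also have "\<dots> \<longleftrightarrow>
         (\<exists>k g. holomorphic_at_origin g \<and> y = \<phi> (\<lambda>p. k * fst p ^ n + fst p ^ Suc n * g p))" (is "_ \<longleftrightarrow> ?R")
        by (intro ex_cong1 conj_cong refl) (simp only: sum)
      finally have "y \<in> Q.line_extension K (\<phi> (\<lambda>p. fst p ^ n)) (E j) \<longleftrightarrow> ?R" .
      moreover have "y \<in> E (Suc j)" if ?R
      proof -
        from that obtain k g where g: "holomorphic_at_origin g"
          "y = \<phi> (\<lambda>p. k * fst p ^ n + fst p ^ Suc n * g p)" by blast
        have "y = \<phi> (\<lambda>p. fst p ^ n * (k + fst p * g p))"
          unfolding g(2) by (simp add: algebra_simps)
        moreover have "holomorphic_at_origin (\<lambda>p. k + fst p * g p)" by (intro hol_intros g)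
        ultimately show ?thesis
          unfolding E_def n_def[symmetric] by (intro image_eqI[of _ _ "\<lambda>p. k + fst p * g p"]) auto
      qed
      moreover have ?R if "y \<in> E (Suc j)"
      proof -
        from that obtain g where g: "holomorphic_at_origin g" "y = \<phi> (\<lambda>p. fst p ^ n * g p)"
          by (auto simp: E_def n_def)
        obtain g1 g2 where h: "holomorphic_at_origin g1" "holomorphic_at_origin g2"
          "\<forall>\<^sub>F p in nhds (0, 0). g p = g (0, 0) + fst p * g1 p + snd p * g2 p"
          using hadamard_at_origin[OF g(1)] by blast
        let ?h = "\<lambda>p. g (0, 0) * fst p ^ n + fst p ^ Suc n * g1 p"
        have "\<forall>\<^sub>F p in nhds (0, 0). fst p ^ n * g p - ?h p = 0 * fst p ^ N + (fst p ^ n * g2 p) * snd p"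
          using h(3) by eventually_elim (simp add: algebra_simps)
        moreover have "holomorphic_at_origin (\<lambda>p. fst p ^ n * g2 p)" by (intro hol_intros h)
        ultimately have "germ_of (\<lambda>p. fst p ^ n * g p - ?h p) \<in> I"
          unfolding mem_I using holomorphic_at_origin_const[of 0] by blast
        then have "\<phi> (\<lambda>p. fst p ^ n * g p) = \<phi> ?h"
          by (subst \<phi>_eq) (intro hol_intros g h, intro hol_intros g h, assumption)
        with g(2) h(1) show ?thesis by blast
      qed
      ultimately show "y \<in> E (Suc j) \<longleftrightarrow> y \<in> Q.line_extension K (\<phi> (\<lambda>p. fst p ^ n)) (E j)" by blast
    qed
    moreover have "\<phi> (\<lambda>p. fst p ^ n) \<notin> E j"
      using pow_notin[OF n(1)] by (auto simp: E_def n(2) simp del: power_Suc)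
    moreover have "\<phi> (\<lambda>p. fst p ^ n) \<in> carrier ?Q" using hol_n by (auto simp: carrier_Q)
    ultimately show ?case using Suc by (auto intro: Q.Suc_dim)
  qed
  have "E N = carrier ?Q" by (auto simp: E_def carrier_Q)
  with dim[of N] have "Q.dimension N K (carrier ?Q)" by simp
  then have "Q.finite_dimension K (carrier ?Q)" "(Q.dim over K) (carrier ?Q) = N"
    using Q.finite_dimensionI Q.finite_dimensionE[OF \<open>subfield K ?Q\<close>]
      Q.dimension_is_inj[OF \<open>subfield K ?Q\<close>] by blast+
  then show ?thesis
    unfolding quotient_dim_def I_def[symmetric] K_def[symmetric] by simp
qed

lemma quotient_dim_germs:
  assumes hol: "holomorphic_at_origin \<beta>" "holomorphic_at_origin \<gamma>"
    and u: "holomorphic_at_origin p1" "holomorphic_at_origin q1" "holomorphic_at_origin p2" "holomorphic_at_origin q2"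
    and \<beta>: "\<forall>\<^sub>F p in nhds (0, 0). \<beta> p = p1 p * fst p ^ N + q1 p * snd p"
    and \<gamma>: "\<forall>\<^sub>F p in nhds (0, 0). \<gamma> p = p2 p * fst p ^ N + q2 p * snd p"
    and det: "p1 (0, 0) * q2 (0, 0) - q1 (0, 0) * p2 (0, 0) \<noteq> 0" and N: "N > 0"
  shows "quotient_dim (Idl\<^bsub>O2\<^esub> {germ_of \<beta>, germ_of \<gamma>}) = enat N"
proof -
  have "holomorphic_at_origin (\<lambda>p. fst p ^ N)" by (intro hol_intros)
  from Idl_germs_unimodular[OF hol this holomorphic_at_origin_snd u \<beta> \<gamma> det]
  show ?thesis by (simp add: quotient_dim_fst_power_snd[OF N])
qed

lemma Idl_germs_unit_mult:
  assumes W: "holomorphic_at_origin W" "W (0, 0) \<noteq> 0"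
    and hol: "holomorphic_at_origin \<beta>" "holomorphic_at_origin \<gamma>"
  shows "Idl\<^bsub>O2\<^esub> {germ_of (\<lambda>p. W p * \<beta> p), germ_of (\<lambda>p. W p * \<gamma> p)} =
    Idl\<^bsub>O2\<^esub> {germ_of \<beta>, germ_of \<gamma>}"
  by (rule Idl_germs_unimodular[of _ _ \<beta> \<gamma> W "\<lambda>_. 0" "\<lambda>_. 0" W])
     (simp_all add: W hol holomorphic_at_origin_mult holomorphic_at_origin_const)

section \<open>Holomorphic extension of real analytic functions\<close>

text \<open>
  A holomorphic extension on a bidisc of fixed radius.  Fixing the radius allows repeated
  differentiation without shrinking the domain.
\<close>

definition extends :: "real \<Rightarrow> (complex \<times> complex \<Rightarrow> complex) \<Rightarrow> (real \<times> real \<Rightarrow> real) \<Rightarrow> bool" where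
  "extends r F f \<longleftrightarrow> hol_polydisc r F \<and>
     (\<forall>x y. \<bar>x\<bar> < r \<longrightarrow> \<bar>y\<bar> < r \<longrightarrow> F (of_real x, of_real y) = of_real (f (x, y)))"

lemma real_analytic_extends:
  assumes "real_analytic_at_origin f"
  obtains F r where "r > 0" "extends r F f"
proof -
  obtain A :: "nat \<times> nat \<Rightarrow> real" and r where r: "r > 0" and
    sums: "\<And>x y. \<bar>x\<bar> < r \<Longrightarrow> \<bar>y\<bar> < r \<Longrightarrow> ((\<lambda>(i, j). A (i, j) * x ^ i * y ^ j) has_sum f (x, y)) UNIV"
    using assms unfolding real_analytic_at_origin_def by blast
  define s where "s = r / 2"
  have s: "s > 0" "s < r" using r by (auto simp: s_def)
  define M where "M = (\<lambda>(i, j). \<bar>A (i, j)\<bar> * s ^ i * s ^ j)"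
  define g where "g = (\<lambda>ij p. complex_of_real (A ij) * fst p ^ fst ij * snd p ^ snd ij)"
  define F where "F = (\<lambda>p. \<Sum>\<^sub>\<infinity>ij. g ij p)"
  have "(\<lambda>(i, j). A (i, j) * s ^ i * s ^ j) summable_on UNIV"
    using sums[of s s] s by (auto simp: summable_on_def)
  then have "(\<lambda>x. norm (case x of (i, j) \<Rightarrow> A (i, j) * s ^ i * s ^ j)) summable_on UNIV"
    by (rule summable_on_iff_abs_summable_on_real[THEN iffD1])
  moreover have "(\<lambda>x. norm (case x of (i, j) \<Rightarrow> A (i, j) * s ^ i * s ^ j)) = M"
    using s by (auto simp: fun_eq_iff M_def abs_mult)
  ultimately have M: "M summable_on UNIV" by simp
  have bound: "norm (g ij p) \<le> M ij" if "p \<in> cball 0 s \<times> cball 0 s" for ij p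
    using that s unfolding g_def M_def norm_mult norm_power norm_of_real
    by (auto simp: case_prod_unfold intro!: mult_mono power_mono)
  have ulim: "uniform_limit (cball 0 s \<times> cball 0 s) (\<lambda>X p. \<Sum>ij\<in>X. g ij p) F (finite_subsets_at_top UNIV)"
    unfolding F_def by (rule Weierstrass_m_test_general[OF bound M])
  have "hol_polydisc s F"
    unfolding hol_polydisc_def
  proof (intro conjI ballI)
    have "continuous_on (cball 0 s \<times> cball 0 s) F"
      by (rule uniform_limit_theorem[OF _ ulim])
         (auto intro!: always_eventually continuous_intros simp: g_def)
    then show "continuous_on (polydisc s) F"
      by (rule continuous_on_subset) (auto simp: polydisc_def)
  next
    fix w :: complex assume w: "w \<in> ball 0 s"
    have "uniform_limit (cball 0 s) (\<lambda>X z. \<Sum>ij\<in>X. g ij (z, w)) (\<lambda>z. F (z, w)) (finite_subsets_at_top UNIV)"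
      by (rule uniform_limit_compose'[OF ulim]) (use w in auto)
    then show "(\<lambda>z. F (z, w)) holomorphic_on ball 0 s"
      by (rule holomorphic_uniform_limit[rotated])
         (auto intro!: always_eventually continuous_intros holomorphic_intros simp: g_def)
  next
    fix z :: complex assume z: "z \<in> ball 0 s"
    have "uniform_limit (cball 0 s) (\<lambda>X w. \<Sum>ij\<in>X. g ij (z, w)) (\<lambda>w. F (z, w)) (finite_subsets_at_top UNIV)"
      by (rule uniform_limit_compose'[OF ulim]) (use z in auto)
    then show "(\<lambda>w. F (z, w)) holomorphic_on ball 0 s"
      by (rule holomorphic_uniform_limit[rotated])
         (auto intro!: always_eventually continuous_intros holomorphic_intros simp: g_def)
  qed
  moreover have "F (of_real x, of_real y) = of_real (f (x, y))" if "\<bar>x\<bar> < s" "\<bar>y\<bar> < s" for x y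
  proof -
    have "((\<lambda>ij. of_real (case ij of (i, j) \<Rightarrow> A (i, j) * x ^ i * y ^ j)) has_sum complex_of_real (f (x, y))) UNIV"
      using sums[of x y] that s by (subst has_sum_of_real_iff) auto
    also have "(\<lambda>ij. of_real (case ij of (i, j) \<Rightarrow> A (i, j) * x ^ i * y ^ j)) =
        (\<lambda>ij. g ij (complex_of_real x, complex_of_real y))"
      by (auto simp: g_def fun_eq_iff)
    finally show ?thesis unfolding F_def by (rule infsumI)
  qed
  ultimately show thesis using that[of s F] s unfolding extends_def by blast
qed

lemma extends_swap: "extends r F f \<Longrightarrow> extends r (F \<circ> prod.swap) (f \<circ> prod.swap)"
  unfolding extends_def using hol_polydisc_swap by simp

lemma partial_y_swap: "partial_y f = partial_x (f \<circ> prod.swap) \<circ> prod.swap"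
  by (auto simp: partial_x_def partial_y_def fun_eq_iff)

text \<open>
  The derivative of the extension is real at real points, since the imaginary part of the extension
  vanishes along the real lines; hence it extends the real partial derivative.
\<close>

lemma extends_partial_x:
  assumes F: "extends r F f"
  shows "extends r (cderiv_fst F) (partial_x f)"
    and "\<And>x y. \<bar>x\<bar> < r \<Longrightarrow> \<bar>y\<bar> < r \<Longrightarrow>
           ((\<lambda>s. f (s, y)) has_vector_derivative partial_x f (x, y)) (at x)"
proof -
  have hol: "hol_polydisc r F" using F by (simp add: extends_def)
  have *: "((\<lambda>s. f (s, y)) has_vector_derivative partial_x f (x, y)) (at x) \<and>
      cderiv_fst F (of_real x, of_real y) = of_real (partial_x f (x, y))"
    if xy: "\<bar>x\<bar> < r" "\<bar>y\<bar> < r" for x y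
  proof -
    let ?D = "cderiv_fst F (of_real x, of_real y)"
    have "((\<lambda>s. F (s, of_real y)) has_field_derivative ?D) (at (of_real x))"
      using xy by (intro hol_polydisc_has_deriv_fst[OF hol]) auto
    then have "((\<lambda>s. F (of_real s, of_real y)) has_vector_derivative ?D) (at x)"
      by (rule has_vector_derivative_real_field)
    then have d: "((\<lambda>s. complex_of_real (f (s, y))) has_vector_derivative ?D) (at x)"
      by (rule has_vector_derivative_transform_within_open[where S = "{-r<..<r}"])
         (use F xy in \<open>auto simp: extends_def\<close>)
    have Re: "((\<lambda>s. f (s, y)) has_vector_derivative Re ?D) (at x)"
      using bounded_linear.has_vector_derivative[OF bounded_linear_Re d] by simp
    have "((\<lambda>s. 0 :: real) has_vector_derivative Im ?D) (at x)"
      using bounded_linear.has_vector_derivative[OF bounded_linear_Im d] by simp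
    then have "Im ?D = 0"
      using vector_derivative_unique_at[OF _ has_vector_derivative_const] by blast
    moreover have "partial_x f (x, y) = Re ?D"
      unfolding partial_x_def using Re by (simp add: vector_derivative_at)
    ultimately show ?thesis using Re by (simp add: complex_eq_iff)
  qed
  then show "\<And>x y. \<bar>x\<bar> < r \<Longrightarrow> \<bar>y\<bar> < r \<Longrightarrow>
           ((\<lambda>s. f (s, y)) has_vector_derivative partial_x f (x, y)) (at x)" by blast
  show "extends r (cderiv_fst F) (partial_x f)"
    unfolding extends_def using hol_polydisc_cderiv_fst[OF hol] * by blast
qed

lemma extends_partial_y:
  assumes F: "extends r F f"
  shows "extends r (cderiv_snd F) (partial_y f)"
    and "\<And>x y. \<bar>x\<bar> < r \<Longrightarrow> \<bar>y\<bar> < r \<Longrightarrow>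
           ((\<lambda>s. f (x, s)) has_vector_derivative partial_y f (x, y)) (at y)"
  unfolding partial_y_swap cderiv_snd_swap
  using extends_swap[OF extends_partial_x(1)[OF extends_swap[OF F]]]
    extends_partial_x(2)[OF extends_swap[OF F]] by simp_all

section \<open>Fundamental forms of a graph\<close>

lemma has_vector_derivative_vector3:
  fixes a b c :: "real \<Rightarrow> real"
  assumes "(a has_vector_derivative a') (at t)" "(b has_vector_derivative b') (at t)"
    "(c has_vector_derivative c') (at t)"
  shows "((\<lambda>s. vector [a s, b s, c s] :: real ^ 3) has_vector_derivative vector [a', b', c']) (at t)"
proof -
  have *: "(vector [u, v, w] :: real ^ 3) = u *\<^sub>R axis 1 1 + v *\<^sub>R axis 2 1 + w *\<^sub>R axis 3 1" for u v w
    by (simp add: vec_eq_iff forall_3 axis_def)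
  have "((\<lambda>s. a s *\<^sub>R axis 1 1 + b s *\<^sub>R axis 2 1 + c s *\<^sub>R axis 3 1 :: real ^ 3) has_vector_derivative
      (a' *\<^sub>R axis 1 1 + b' *\<^sub>R axis 2 1 + c' *\<^sub>R axis 3 1)) (at t)"
    using assms
    by (intro has_vector_derivative_add bounded_linear.has_vector_derivative[OF bounded_linear_scaleR_left])
  then show ?thesis by (simp add: *)
qed

lemma partial_x_graph:
  assumes "((\<lambda>s. f (s, y)) has_vector_derivative p) (at x)"
  shows "partial_x (graph_param f) (x, y) = vector [1, 0, p]"
  unfolding partial_x_def graph_param_def fst_conv snd_conv
  by (intro vector_derivative_at has_vector_derivative_vector3 assms has_vector_derivative_const
      has_vector_derivative_id)

lemma partial_y_graph:
  assumes "((\<lambda>s. f (x, s)) has_vector_derivative q) (at y)"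
  shows "partial_y (graph_param f) (x, y) = vector [0, 1, q]"
  unfolding partial_y_def graph_param_def fst_conv snd_conv
  by (intro vector_derivative_at has_vector_derivative_vector3 assms has_vector_derivative_const
      has_vector_derivative_id)

text \<open>
  Differentiating \<open>X\<close> at a point uses its form nearby; in the applications \<open>X\<close> is a first derivative
  of the parametrisation, known on a square.
\<close>

lemma partial_x_vector3:
  assumes X: "\<And>x y. \<bar>x\<bar> < r \<Longrightarrow> \<bar>y\<bar> < r \<Longrightarrow> X (x, y) = vector [u, v, g (x, y)]"
    and xy: "\<bar>x\<bar> < r" "\<bar>y\<bar> < r"
    and g: "((\<lambda>s. g (s, y)) has_vector_derivative d) (at x)"
  shows "partial_x X (x, y) = (vector [0, 0, d] :: real ^ 3)"
proof -
  have "((\<lambda>s. vector [u, v, g (s, y)] :: real ^ 3) has_vector_derivative vector [0, 0, d]) (at x)"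
    by (intro has_vector_derivative_vector3 has_vector_derivative_const g)
  then have "((\<lambda>s. X (s, y)) has_vector_derivative vector [0, 0, d]) (at x)"
    by (rule has_vector_derivative_transform_within_open[where S = "{-r<..<r}"]) (use X xy in auto)
  then show ?thesis unfolding partial_x_def by (simp add: vector_derivative_at)
qed

lemma partial_y_vector3:
  assumes X: "\<And>x y. \<bar>x\<bar> < r \<Longrightarrow> \<bar>y\<bar> < r \<Longrightarrow> X (x, y) = vector [u, v, g (x, y)]"
    and xy: "\<bar>x\<bar> < r" "\<bar>y\<bar> < r"
    and g: "((\<lambda>s. g (x, s)) has_vector_derivative d) (at y)"
  shows "partial_y X (x, y) = (vector [0, 0, d] :: real ^ 3)"
proof -
  have "((\<lambda>s. vector [u, v, g (x, s)] :: real ^ 3) has_vector_derivative vector [0, 0, d]) (at y)"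
    by (intro has_vector_derivative_vector3 has_vector_derivative_const g)
  then have "((\<lambda>s. X (x, s)) has_vector_derivative vector [0, 0, d]) (at y)"
    by (rule has_vector_derivative_transform_within_open[where S = "{-r<..<r}"]) (use X xy in auto)
  then show ?thesis unfolding partial_y_def by (simp add: vector_derivative_at)
qed

text \<open>
  The normal direction is \<open>(- p, - q, 1)\<close>, and all second derivatives of the parametrisation are
  vertical.
\<close>

lemma fundamental_forms_graph:
  fixes f :: "real \<times> real \<Rightarrow> real"
  assumes F: "extends r F f" and xy: "\<bar>x\<bar> < r" "\<bar>y\<bar> < r"
  defines "p \<equiv> partial_x f (x, y)" and "q \<equiv> partial_y f (x, y)"
  defines "W \<equiv> sqrt (1 + p\<^sup>2 + q\<^sup>2)"
  shows "coeff_E (graph_param f) (x, y) = 1 + p\<^sup>2"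
    "coeff_F (graph_param f) (x, y) = p * q"
    "coeff_G (graph_param f) (x, y) = 1 + q\<^sup>2"
    "coeff_l (graph_param f) (x, y) = partial_x (partial_x f) (x, y) / W"
    "coeff_m (graph_param f) (x, y) = partial_y (partial_x f) (x, y) / W"
    "coeff_n (graph_param f) (x, y) = partial_y (partial_y f) (x, y) / W"
proof -
  note Fx = extends_partial_x[OF F] and Fy = extends_partial_y[OF F]
  have Xx: "partial_x (graph_param f) (x, y) = vector [1, 0, partial_x f (x, y)]"
    if "\<bar>x\<bar> < r" "\<bar>y\<bar> < r" for x y by (rule partial_x_graph[OF Fx(2)[OF that]])
  have Xy: "partial_y (graph_param f) (x, y) = vector [0, 1, partial_y f (x, y)]"
    if "\<bar>x\<bar> < r" "\<bar>y\<bar> < r" for x y by (rule partial_y_graph[OF Fy(2)[OF that]])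
  have Xxx: "partial_x (partial_x (graph_param f)) (x, y) = vector [0, 0, partial_x (partial_x f) (x, y)]"
    by (rule partial_x_vector3[OF Xx xy extends_partial_x(2)[OF Fx(1) xy]])
  have Xxy: "partial_y (partial_x (graph_param f)) (x, y) = vector [0, 0, partial_y (partial_x f) (x, y)]"
    by (rule partial_y_vector3[OF Xx xy extends_partial_y(2)[OF Fx(1) xy]])
  have Xyy: "partial_y (partial_y (graph_param f)) (x, y) = vector [0, 0, partial_y (partial_y f) (x, y)]"
    by (rule partial_y_vector3[OF Xy xy extends_partial_y(2)[OF Fy(1) xy]])
  have normal: "unit_normal (graph_param f) (x, y) = sgn (vector [- p, - q, 1])"
    unfolding unit_normal_def Xx[OF xy] Xy[OF xy] by (simp add: cross3_def p_def q_def)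
  have "norm (vector [- p, - q, 1] :: real ^ 3) = W"
    by (simp add: norm_eq_sqrt_inner inner_vec_def sum_3 W_def power2_eq_square algebra_simps)
  then have second: "(vector [0, 0, d] :: real ^ 3) \<bullet> unit_normal (graph_param f) (x, y) = d / W" for d
    unfolding normal sgn_div_norm by (simp add: inner_vec_def sum_3 divide_inverse)
  show "coeff_E (graph_param f) (x, y) = 1 + p\<^sup>2" "coeff_F (graph_param f) (x, y) = p * q"
    "coeff_G (graph_param f) (x, y) = 1 + q\<^sup>2"
    by (simp_all add: coeff_E_def coeff_F_def coeff_G_def Xx[OF xy] Xy[OF xy] inner_vec_def sum_3
        p_def q_def power2_eq_square)
  show "coeff_l (graph_param f) (x, y) = partial_x (partial_x f) (x, y) / W"
    "coeff_m (graph_param f) (x, y) = partial_y (partial_x f) (x, y) / W"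
    "coeff_n (graph_param f) (x, y) = partial_y (partial_y f) (x, y) / W"
    by (simp_all add: coeff_l_def coeff_m_def coeff_n_def Xxx Xxy Xyy second)
qed

text \<open>
  The numerators of \<open>\<bb>\<close> and \<open>\<cc>\<close> for the graph of a function with holomorphic extension \<open>F\<close>.
\<close>

definition curv_b :: "(complex \<times> complex \<Rightarrow> complex) \<Rightarrow> complex \<times> complex \<Rightarrow> complex" where
  "curv_b F p = (1 + (cderiv_fst F p)\<^sup>2) * cderiv_snd (cderiv_snd F) p
             - (1 + (cderiv_snd F p)\<^sup>2) * cderiv_fst (cderiv_fst F) p"

definition curv_c :: "(complex \<times> complex \<Rightarrow> complex) \<Rightarrow> complex \<times> complex \<Rightarrow> complex" where
  "curv_c F p = (1 + (cderiv_fst F p)\<^sup>2) * cderiv_snd (cderiv_fst F) p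
             - cderiv_fst F p * cderiv_snd F p * cderiv_fst (cderiv_fst F) p"

lemma holomorphic_at_origin_curv:
  assumes "holomorphic_at_origin F"
  shows "holomorphic_at_origin (curv_b F)" "holomorphic_at_origin (curv_c F)"
  unfolding curv_b_def[abs_def] curv_c_def[abs_def]
  by (intro hol_intros holomorphic_at_origin_cderiv_fst holomorphic_at_origin_cderiv_snd assms)+

text \<open>
  The factor \<open>1 / sqrt (1 + p\<^sup>2 + q\<^sup>2)\<close> extends to a holomorphic unit, because the radicand is 1 at
  the origin and so avoids the cut of the complex square root.
\<close>

lemma umbilic_multiplicity_graph:
  assumes r: "r > 0" and F: "extends r F f"
    and crit: "cderiv_fst F (0, 0) = 0" "cderiv_snd F (0, 0) = 0"
  shows "umbilic_multiplicity (graph_param f) = quotient_dim (Idl\<^bsub>O2\<^esub> {germ_of (curv_b F), germ_of (curv_c F)})"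
proof -
  have hol: "holomorphic_at_origin F"
    using r F unfolding extends_def holomorphic_at_origin_iff_polydisc by blast
  define V where "V = (\<lambda>p. 1 + (cderiv_fst F p)\<^sup>2 + (cderiv_snd F p)\<^sup>2)"
  have V: "holomorphic_at_origin V"
    unfolding V_def
    by (intro hol_intros holomorphic_at_origin_cderiv_fst holomorphic_at_origin_cderiv_snd hol)
  have V0: "V (0, 0) = 1" by (simp add: V_def crit)
  define W where "W = (\<lambda>p. inverse (csqrt (V p)))"
  have "holomorphic_at_origin (\<lambda>p. csqrt (V p))"
    by (rule holomorphic_at_origin_compose[OF V, of csqrt "- \<real>\<^sub>\<le>\<^sub>0"])
       (auto simp: V0 intro!: holomorphic_on_csqrt)
  then have W: "holomorphic_at_origin W"
    unfolding W_def by (rule holomorphic_at_origin_inverse) (simp add: V0)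
  have W0: "W (0, 0) \<noteq> 0" by (simp add: W_def V0)
  have real: "W (of_real x, of_real y) * curv_b F (of_real x, of_real y) = of_real (lpc_b (graph_param f) (x, y))
      \<and> W (of_real x, of_real y) * curv_c F (of_real x, of_real y) = of_real (lpc_c (graph_param f) (x, y))"
    if xy: "\<bar>x\<bar> < r" "\<bar>y\<bar> < r" for x y
  proof -
    note Fx = extends_partial_x(1)[OF F] and Fy = extends_partial_y(1)[OF F]
    note Fxx = extends_partial_x(1)[OF Fx] and Fxy = extends_partial_y(1)[OF Fx] and Fyy = extends_partial_y(1)[OF Fy]
    have ext: "G (of_real x, of_real y) = of_real (g (x, y))" if "extends r G g" for G g
      using that xy by (simp add: extends_def)
    let ?v = "1 + (partial_x f (x, y))\<^sup>2 + (partial_y f (x, y))\<^sup>2"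
    have "V (of_real x, of_real y) = of_real ?v"
      unfolding V_def ext[OF Fx] ext[OF Fy] by simp
    moreover have "csqrt (of_real ?v) = of_real (sqrt ?v)"
      by (rule csqrt_of_real_nonneg[THEN trans]) auto
    ultimately have "W (of_real x, of_real y) = of_real (inverse (sqrt ?v))"
      by (simp add: W_def)
    then show ?thesis
      unfolding curv_b_def curv_c_def ext[OF Fx] ext[OF Fy] ext[OF Fxx] ext[OF Fxy] ext[OF Fyy]
        lpc_b_def lpc_c_def fundamental_forms_graph[OF F xy]
      by (simp add: divide_inverse algebra_simps)
  qed
  have ev: "\<forall>\<^sub>F v :: real \<times> real in nhds (0, 0). v \<in> polydisc r"
    using r unfolding eventually_nhds_origin_polydisc by blast
  have "complexify (lpc_b (graph_param f)) = germ_of (\<lambda>p. W p * curv_b F p)"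
  proof (rule complexify_eq)
    show "\<forall>\<^sub>F (x, y) in nhds (0, 0). W (of_real x, of_real y) * curv_b F (of_real x, of_real y) =
        of_real (lpc_b (graph_param f) (x, y))"
      using ev by eventually_elim (auto simp: real)
  qed (intro holomorphic_at_origin_mult W holomorphic_at_origin_curv hol)
  moreover have "complexify (lpc_c (graph_param f)) = germ_of (\<lambda>p. W p * curv_c F p)"
  proof (rule complexify_eq)
    show "\<forall>\<^sub>F (x, y) in nhds (0, 0). W (of_real x, of_real y) * curv_c F (of_real x, of_real y) =
        of_real (lpc_c (graph_param f) (x, y))"
      using ev by eventually_elim (auto simp: real)
  qed (intro holomorphic_at_origin_mult W holomorphic_at_origin_curv hol)
  ultimately show ?thesis
    unfolding umbilic_multiplicity_def
    by (simp add: Idl_germs_unit_mult[OF W W0] holomorphic_at_origin_curv[OF hol])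
qed

section \<open>Taylor expansion of the principal curvature equation\<close>

text \<open>
  Since \<open>p\<close> and \<open>q\<close> agree with \<open>\<kappa> x\<close> and \<open>\<kappa> y\<close> to first order, the products with first derivatives
  contribute to the second order only the terms \<open>\<kappa>\<^sup>3 (x\<^sup>2 - y\<^sup>2)\<close> and \<open>- \<kappa>\<^sup>3 x y\<close>.
\<close>

lemma curv_jets:
  fixes F :: "complex \<times> complex \<Rightarrow> complex" and \<kappa> :: complex
  assumes hol: "holomorphic_at_origin F"
    and P: "ord_ge 2 (\<lambda>p. cderiv_fst F p - \<kappa> * fst p)"
    and Q: "ord_ge 2 (\<lambda>p. cderiv_snd F p - \<kappa> * snd p)"
    and R: "ord_ge 3 (\<lambda>p. cderiv_fst (cderiv_fst F) p - (\<kappa> + R1 p))" "R1 (0, 0) = 0"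
    and S: "ord_ge 3 (\<lambda>p. cderiv_snd (cderiv_fst F) p - S1 p)" "S1 (0, 0) = 0"
    and T: "ord_ge 3 (\<lambda>p. cderiv_snd (cderiv_snd F) p - (\<kappa> + T1 p))" "T1 (0, 0) = 0"
  shows "ord_ge 3 (\<lambda>p. curv_b F p - (T1 p - R1 p + \<kappa> ^ 3 * ((fst p)\<^sup>2 - (snd p)\<^sup>2)))"
    and "ord_ge 3 (\<lambda>p. curv_c F p - (S1 p - \<kappa> ^ 3 * fst p * snd p))"
proof -
  let ?P = "cderiv_fst F" and ?Q = "cderiv_snd F"
  let ?R = "cderiv_fst (cderiv_fst F)" and ?S = "cderiv_snd (cderiv_fst F)" and ?T = "cderiv_snd (cderiv_snd F)"
  have hols: "holomorphic_at_origin ?P" "holomorphic_at_origin ?Q" "holomorphic_at_origin ?R"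
    "holomorphic_at_origin ?S" "holomorphic_at_origin ?T"
    by (intro holomorphic_at_origin_cderiv_fst holomorphic_at_origin_cderiv_snd hol)+
  have zero: "e (0, 0) = 0" if "ord_ge (Suc k) e" for k e
  proof -
    have "ord_ge 1 e" by (rule ord_ge_mono[OF that]) simp
    then show ?thesis unfolding ord_ge_1_iff by blast
  qed
  have at0: "?P (0, 0) = 0" "?Q (0, 0) = 0" "?R (0, 0) = \<kappa>" "?S (0, 0) = 0" "?T (0, 0) = \<kappa>"
    using zero[OF P[unfolded numeral_2_eq_2]] zero[OF Q[unfolded numeral_2_eq_2]]
      zero[OF R(1)[unfolded numeral_3_eq_3]] zero[OF S(1)[unfolded numeral_3_eq_3]]
      zero[OF T(1)[unfolded numeral_3_eq_3]] R(2) S(2) T(2) by simp_all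
  have ord1: "ord_ge 1 ?P" "ord_ge 1 ?Q" "ord_ge 1 (\<lambda>p. ?R p - \<kappa>)" "ord_ge 1 ?S" "ord_ge 1 (\<lambda>p. ?T p - \<kappa>)"
    "ord_ge 1 (\<lambda>p. ?P p + \<kappa> * fst p)" "ord_ge 1 (\<lambda>p. ?Q p + \<kappa> * snd p)"
    "ord_ge 1 (\<lambda>p. \<kappa>\<^sup>2 * fst p)" "ord_ge 1 (\<lambda>p. \<kappa>\<^sup>2 * snd p)" "ord_ge 1 (\<lambda>p. \<kappa> * fst p)"
    unfolding ord_ge_1_iff by (simp_all add: at0) (intro hol_intros hols)+
  have m3: "ord_ge 3 (\<lambda>p. e p * (g p * h p))" if "ord_ge 1 e" "ord_ge 1 g" "ord_ge 1 h" for e g h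
    using ord_ge_mult[OF that(1) ord_ge_mult[OF that(2,3)]] by (simp add: numeral_3_eq_3)
  have m2: "ord_ge 3 (\<lambda>p. h p * (e p * g p))" if "ord_ge 2 e" "ord_ge 1 g" "holomorphic_at_origin h" for e g h
    using ord_ge_holomorphic_mult[OF that(3) ord_ge_mult[OF that(1,2)]] by (simp add: numeral_3_eq_3)
  \<comment> \<open>The remainder is rearranged into products whose factors have total order 3.\<close>
  have "ord_ge 3 (\<lambda>p. ((?T p - (\<kappa> + T1 p)) - (?R p - (\<kappa> + R1 p)))
      + (fst p * ((\<kappa>\<^sup>2 * fst p) * (?T p - \<kappa>)) + ?T p * ((?P p - \<kappa> * fst p) * (?P p + \<kappa> * fst p)))
      - (snd p * ((\<kappa>\<^sup>2 * snd p) * (?R p - \<kappa>)) + ?R p * ((?Q p - \<kappa> * snd p) * (?Q p + \<kappa> * snd p))))"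
    by (intro ord_ge_add ord_ge_diff m3 m2 ord1 hols P Q R(1) T(1) ord_ge_fst ord_ge_snd)
  then show "ord_ge 3 (\<lambda>p. curv_b F p - (T1 p - R1 p + \<kappa> ^ 3 * ((fst p)\<^sup>2 - (snd p)\<^sup>2)))"
    by (rule ord_ge_cong)
       (intro always_eventually allI, simp add: curv_b_def power2_eq_square power3_eq_cube algebra_simps)
  have "ord_ge 3 (\<lambda>p. (?S p - S1 p) + ?P p * (?P p * ?S p)
      - (?R p * ((?P p - \<kappa> * fst p) * ?Q p) + ?R p * ((?Q p - \<kappa> * snd p) * (\<kappa> * fst p))
         + fst p * ((\<kappa>\<^sup>2 * snd p) * (?R p - \<kappa>))))"
    by (intro ord_ge_add ord_ge_diff m3 m2 ord1 hols P Q S(1) ord_ge_fst ord_ge_snd)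
  then show "ord_ge 3 (\<lambda>p. curv_c F p - (S1 p - \<kappa> ^ 3 * fst p * snd p))"
    by (rule ord_ge_cong)
       (intro always_eventually allI, simp add: curv_c_def power2_eq_square power3_eq_cube algebra_simps)
qed

lemma ord_ge_2I:
  assumes "ord_ge 1 g" "ord_ge 1 h"
  shows "ord_ge 2 (\<lambda>p. fst p * g p + snd p * h p)"
  unfolding numeral_2_eq_2 One_nat_def[symmetric]
  using assms by (rule ord_ge_SucI) simp

text \<open>
  Differentiation of the Monge form; each derivative costs one order of the remainder, and order 3
  is left for the second derivatives.
\<close>

lemma monge_form_jets:
  fixes F :: "complex \<times> complex \<Rightarrow> complex" and \<kappa> a b c d40 d31 d22 d13 d04 :: complex
  assumes hol: "holomorphic_at_origin F"
    and jet: "ord_ge 5 (\<lambda>p. F p - (\<kappa> / 2 * (fst p ^ 2 + snd p ^ 2)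
             + a / 6 * fst p ^ 3 + b / 2 * fst p * snd p ^ 2 + c / 6 * snd p ^ 3
             + d40 / 24 * fst p ^ 4 + d31 / 6 * fst p ^ 3 * snd p + d22 / 4 * fst p ^ 2 * snd p ^ 2
             + d13 / 6 * fst p * snd p ^ 3 + d04 / 24 * snd p ^ 4))"
  shows "ord_ge 2 (\<lambda>p. cderiv_fst F p - \<kappa> * fst p)"
    and "ord_ge 2 (\<lambda>p. cderiv_snd F p - \<kappa> * snd p)"
    and "ord_ge 3 (\<lambda>p. cderiv_fst (cderiv_fst F) p -
           (\<kappa> + (a * fst p + d40 / 2 * fst p ^ 2 + d31 * fst p * snd p + d22 / 2 * snd p ^ 2)))"
    and "ord_ge 3 (\<lambda>p. cderiv_snd (cderiv_fst F) p -
           (b * snd p + d31 / 2 * fst p ^ 2 + d22 * fst p * snd p + d13 / 2 * snd p ^ 2))"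
    and "ord_ge 3 (\<lambda>p. cderiv_snd (cderiv_snd F) p -
           (\<kappa> + (b * fst p + c * snd p + d22 / 2 * fst p ^ 2 + d13 * fst p * snd p + d04 / 2 * snd p ^ 2)))"
proof -
  define X where "X = (\<lambda>p :: complex \<times> complex. \<kappa> * fst p + a / 2 * fst p ^ 2 + b / 2 * snd p ^ 2
     + d40 / 6 * fst p ^ 3 + d31 / 2 * fst p ^ 2 * snd p + d22 / 2 * fst p * snd p ^ 2 + d13 / 6 * snd p ^ 3)"
  define Y where "Y = (\<lambda>p :: complex \<times> complex. \<kappa> * snd p + b * fst p * snd p + c / 2 * snd p ^ 2
     + d31 / 6 * fst p ^ 3 + d22 / 2 * fst p ^ 2 * snd p + d13 / 2 * fst p * snd p ^ 2 + d04 / 6 * snd p ^ 3)"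
  have holX: "holomorphic_at_origin X" unfolding X_def by (intro hol_intros)
  have holY: "holomorphic_at_origin Y" unfolding Y_def by (intro hol_intros)
  have jet': "ord_ge (Suc 4) (\<lambda>p. F p - (\<kappa> / 2 * (fst p ^ 2 + snd p ^ 2)
             + a / 6 * fst p ^ 3 + b / 2 * fst p * snd p ^ 2 + c / 6 * snd p ^ 3
             + d40 / 24 * fst p ^ 4 + d31 / 6 * fst p ^ 3 * snd p + d22 / 4 * fst p ^ 2 * snd p ^ 2
             + d13 / 6 * fst p * snd p ^ 3 + d04 / 24 * snd p ^ 4))"
    by (rule ord_ge_mono[OF jet]) simp
  have "ord_ge 4 (\<lambda>p. cderiv_fst F p - X p)"
  proof (rule ord_ge_cderiv_fst_diff[OF hol _ jet'])
    fix z w :: complex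
    show "((\<lambda>s. \<kappa> / 2 * (fst (s, w) ^ 2 + snd (s, w) ^ 2)
             + a / 6 * fst (s, w) ^ 3 + b / 2 * fst (s, w) * snd (s, w) ^ 2 + c / 6 * snd (s, w) ^ 3
             + d40 / 24 * fst (s, w) ^ 4 + d31 / 6 * fst (s, w) ^ 3 * snd (s, w) + d22 / 4 * fst (s, w) ^ 2 * snd (s, w) ^ 2
             + d13 / 6 * fst (s, w) * snd (s, w) ^ 3 + d04 / 24 * snd (s, w) ^ 4)
        has_field_derivative X (z, w)) (at z)"
      unfolding fst_conv snd_conv X_def by (auto intro!: derivative_eq_intros simp: field_simps power2_eq_square power3_eq_cube)
  qed (intro hol_intros)
  then have X3: "ord_ge (Suc 3) (\<lambda>p. cderiv_fst F p - X p)" by (rule ord_ge_mono) simp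
  have "ord_ge 4 (\<lambda>p. cderiv_snd F p - Y p)"
  proof (rule ord_ge_cderiv_snd_diff[OF hol _ jet'])
    fix z w :: complex
    show "((\<lambda>s. \<kappa> / 2 * (fst (z, s) ^ 2 + snd (z, s) ^ 2)
             + a / 6 * fst (z, s) ^ 3 + b / 2 * fst (z, s) * snd (z, s) ^ 2 + c / 6 * snd (z, s) ^ 3
             + d40 / 24 * fst (z, s) ^ 4 + d31 / 6 * fst (z, s) ^ 3 * snd (z, s) + d22 / 4 * fst (z, s) ^ 2 * snd (z, s) ^ 2
             + d13 / 6 * fst (z, s) * snd (z, s) ^ 3 + d04 / 24 * snd (z, s) ^ 4)
        has_field_derivative Y (z, w)) (at w)"
      unfolding fst_conv snd_conv Y_def by (auto intro!: derivative_eq_intros simp: field_simps power2_eq_square power3_eq_cube)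
  qed (intro hol_intros)
  then have Y3: "ord_ge (Suc 3) (\<lambda>p. cderiv_snd F p - Y p)" by (rule ord_ge_mono) simp
  have "ord_ge 1 (\<lambda>p. a / 2 * fst p + d40 / 6 * fst p ^ 2 + d31 / 2 * fst p * snd p + d22 / 2 * snd p ^ 2)"
    "ord_ge 1 (\<lambda>p. b / 2 * snd p + d13 / 6 * snd p ^ 2)"
    unfolding ord_ge_1_iff by (intro conjI hol_intros, simp)+
  from ord_ge_add[OF ord_ge_mono[OF X3] ord_ge_2I[OF this]]
  have "ord_ge 2 (\<lambda>p. (cderiv_fst F p - X p) +
      (fst p * (a / 2 * fst p + d40 / 6 * fst p ^ 2 + d31 / 2 * fst p * snd p + d22 / 2 * snd p ^ 2)
        + snd p * (b / 2 * snd p + d13 / 6 * snd p ^ 2)))" by simp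
  then show "ord_ge 2 (\<lambda>p. cderiv_fst F p - \<kappa> * fst p)"
    by (rule ord_ge_cong)
       (intro always_eventually allI, simp add: X_def power2_eq_square power3_eq_cube algebra_simps)
  have "ord_ge 1 (\<lambda>p. b * snd p + d31 / 6 * fst p ^ 2 + d22 / 2 * fst p * snd p + d13 / 2 * snd p ^ 2)"
    "ord_ge 1 (\<lambda>p. c / 2 * snd p + d04 / 6 * snd p ^ 2)"
    unfolding ord_ge_1_iff by (intro conjI hol_intros, simp)+
  from ord_ge_add[OF ord_ge_mono[OF Y3] ord_ge_2I[OF this]]
  have "ord_ge 2 (\<lambda>p. (cderiv_snd F p - Y p) +
      (fst p * (b * snd p + d31 / 6 * fst p ^ 2 + d22 / 2 * fst p * snd p + d13 / 2 * snd p ^ 2)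
        + snd p * (c / 2 * snd p + d04 / 6 * snd p ^ 2)))" by simp
  then show "ord_ge 2 (\<lambda>p. cderiv_snd F p - \<kappa> * snd p)"
    by (rule ord_ge_cong)
       (intro always_eventually allI, simp add: Y_def power2_eq_square power3_eq_cube algebra_simps)
  show "ord_ge 3 (\<lambda>p. cderiv_fst (cderiv_fst F) p -
           (\<kappa> + (a * fst p + d40 / 2 * fst p ^ 2 + d31 * fst p * snd p + d22 / 2 * snd p ^ 2)))"
    by (rule ord_ge_cderiv_fst_diff[OF holomorphic_at_origin_cderiv_fst[OF hol] holX X3])
       (auto simp: X_def field_simps power2_eq_square intro!: derivative_eq_intros)
  show "ord_ge 3 (\<lambda>p. cderiv_snd (cderiv_fst F) p -
           (b * snd p + d31 / 2 * fst p ^ 2 + d22 * fst p * snd p + d13 / 2 * snd p ^ 2))"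
    by (rule ord_ge_cderiv_snd_diff[OF holomorphic_at_origin_cderiv_fst[OF hol] holX X3])
       (auto simp: X_def field_simps power2_eq_square intro!: derivative_eq_intros)
  show "ord_ge 3 (\<lambda>p. cderiv_snd (cderiv_snd F) p -
           (\<kappa> + (b * fst p + c * snd p + d22 / 2 * fst p ^ 2 + d13 * fst p * snd p + d04 / 2 * snd p ^ 2)))"
    by (rule ord_ge_cderiv_snd_diff[OF holomorphic_at_origin_cderiv_snd[OF hol] holY Y3])
       (auto simp: Y_def field_simps power2_eq_square intro!: derivative_eq_intros)
qed

theorem proposition4p1:
  fixes f :: "real \<times> real \<Rightarrow> real"
    and \<kappa> a b c d40 d31 d22 d13 d04 :: real
  assumes "real_analytic_at_origin f"
    and "(\<lambda>(x, y). f (x, y) -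
            (\<kappa> / 2 * (x\<^sup>2 + y\<^sup>2)
             + a / 6 * x ^ 3 + b / 2 * x * y\<^sup>2 + c / 6 * y ^ 3
             + d40 / 24 * x ^ 4 + d31 / 6 * x ^ 3 * y + d22 / 4 * x\<^sup>2 * y\<^sup>2
             + d13 / 6 * x * y ^ 3 + d04 / 24 * y ^ 4))
         \<in> O[nhds (0, 0)](\<lambda>p. norm p ^ 5)"
  shows "umbilic_at (graph_param f) (0, 0) \<and>
    (D12_umbilic a b c \<longrightarrow> umbilic_multiplicity (graph_param f) = 1) \<and>
    (D123_umbilic \<kappa> a b c d40 d31 d22 \<longrightarrow> umbilic_multiplicity (graph_param f) = 2)"
proof -
  obtain F r where r: "r > 0" and F: "extends r F f"
    using real_analytic_extends[OF assms(1)] by blast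
  have hol: "holomorphic_at_origin F"
    using r F unfolding extends_def holomorphic_at_origin_iff_polydisc by blast
  let ?c = complex_of_real
  define T where "T = (\<lambda>p. ?c \<kappa> / 2 * (fst p ^ 2 + snd p ^ 2)
             + ?c a / 6 * fst p ^ 3 + ?c b / 2 * fst p * snd p ^ 2 + ?c c / 6 * snd p ^ 3
             + ?c d40 / 24 * fst p ^ 4 + ?c d31 / 6 * fst p ^ 3 * snd p + ?c d22 / 4 * fst p ^ 2 * snd p ^ 2
             + ?c d13 / 6 * fst p * snd p ^ 3 + ?c d04 / 24 * snd p ^ 4)"
  have holT: "holomorphic_at_origin T" unfolding T_def by (intro hol_intros)
  have "ord_ge 5 (\<lambda>p. F p - T p)"
  proof (rule ord_ge_from_real_bigo[OF holomorphic_at_origin_diff[OF hol holT]])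
    obtain C where C: "\<forall>\<^sub>F v in nhds (0, 0). norm ((\<lambda>(x, y). f (x, y) -
            (\<kappa> / 2 * (x\<^sup>2 + y\<^sup>2)
             + a / 6 * x ^ 3 + b / 2 * x * y\<^sup>2 + c / 6 * y ^ 3
             + d40 / 24 * x ^ 4 + d31 / 6 * x ^ 3 * y + d22 / 4 * x\<^sup>2 * y\<^sup>2
             + d13 / 6 * x * y ^ 3 + d04 / 24 * y ^ 4)) v) \<le> C * norm (norm v ^ 5)"
      using landau_o.bigE[OF assms(2)] by blast
    have ev: "\<forall>\<^sub>F v :: real \<times> real in nhds (0, 0). v \<in> polydisc r"
      using r unfolding eventually_nhds_origin_polydisc by blast
    show "(\<lambda>v. F (complex_point v) - T (complex_point v)) \<in> O[nhds (0, 0)](\<lambda>v. of_real (norm v ^ 5))"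
    proof (rule bigoI)
      show "\<forall>\<^sub>F v in nhds (0, 0). cmod (F (complex_point v) - T (complex_point v)) \<le>
          C * cmod (of_real (norm v ^ 5))"
        using C ev
      proof eventually_elim
        case (elim v)
        obtain x y where v: "v = (x, y)" by (cases v)
        have "F (complex_point v) - T (complex_point v) = ?c (f (x, y) -
            (\<kappa> / 2 * (x\<^sup>2 + y\<^sup>2)
             + a / 6 * x ^ 3 + b / 2 * x * y\<^sup>2 + c / 6 * y ^ 3
             + d40 / 24 * x ^ 4 + d31 / 6 * x ^ 3 * y + d22 / 4 * x\<^sup>2 * y\<^sup>2
             + d13 / 6 * x * y ^ 3 + d04 / 24 * y ^ 4))"
          using F elim(2) by (simp add: extends_def v complex_point_def T_def)
        with elim(1) show ?case unfolding v by (simp only: norm_of_real prod.case real_norm_def)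
      qed
    qed
  qed
  note jets = monge_form_jets[OF hol this[unfolded T_def]]
  have crit: "cderiv_fst F (0, 0) = 0" "cderiv_snd F (0, 0) = 0"
    using jets(1,2)[THEN ord_ge_mono[of _ _ 1]] by (simp_all add: ord_ge_1_iff del: One_nat_def ord_ge.simps)
  have hess: "cderiv_fst (cderiv_fst F) (0, 0) = ?c \<kappa>" "cderiv_snd (cderiv_fst F) (0, 0) = 0"
    "cderiv_snd (cderiv_snd F) (0, 0) = ?c \<kappa>"
    using jets(3-5)[THEN ord_ge_mono[of _ _ 1]] by (simp_all add: ord_ge_1_iff del: One_nat_def ord_ge.simps)
  have "umbilic_at (graph_param f) (0, 0)"
  proof -
    note Fx = extends_partial_x(1)[OF F] and Fy = extends_partial_y(1)[OF F]
    have ext: "g (0, 0) = Re (G (0, 0))" if "extends r G g" for G g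
      using that r unfolding extends_def by (metis Re_complex_of_real abs_zero of_real_0)
    have "\<bar>0 :: real\<bar> < r" using r by simp
    note forms = fundamental_forms_graph[OF F this this, unfolded ext[OF Fx] ext[OF Fy]
      ext[OF extends_partial_x(1)[OF Fx]] ext[OF extends_partial_y(1)[OF Fx]] ext[OF extends_partial_y(1)[OF Fy]]
      crit hess]
    show ?thesis unfolding umbilic_at_def forms by (intro exI[of _ \<kappa>]) simp
  qed
  moreover
  note curv = curv_jets[OF hol jets(1,2,3) _ jets(4) _ jets(5)]
  obtain u v where uv: "ord_ge 1 u" "ord_ge 1 v" "\<forall>\<^sub>F p in nhds (0, 0). curv_b F p -
      (?c b * fst p + ?c c * snd p + ?c d22 / 2 * fst p ^ 2 + ?c d13 * fst p * snd p + ?c d04 / 2 * snd p ^ 2 -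
       (?c a * fst p + ?c d40 / 2 * fst p ^ 2 + ?c d31 * fst p * snd p + ?c d22 / 2 * snd p ^ 2)
       + ?c \<kappa> ^ 3 * ((fst p)\<^sup>2 - (snd p)\<^sup>2)) = u p * fst p ^ 2 + v p * snd p"
    by (rule ord_ge_3E[OF curv(1)]) simp_all
  obtain u' v' where uv': "ord_ge 1 u'" "ord_ge 1 v'" "\<forall>\<^sub>F p in nhds (0, 0). curv_c F p -
      (?c b * snd p + ?c d31 / 2 * fst p ^ 2 + ?c d22 * fst p * snd p + ?c d13 / 2 * snd p ^ 2
       - ?c \<kappa> ^ 3 * fst p * snd p) = u' p * fst p ^ 2 + v' p * snd p"
    by (rule ord_ge_3E[OF curv(2)]) simp_all
  have hol_uv: "holomorphic_at_origin u" "holomorphic_at_origin v" "holomorphic_at_origin u'" "holomorphic_at_origin v'"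
    and uv0: "u (0, 0) = 0" "v (0, 0) = 0" "u' (0, 0) = 0" "v' (0, 0) = 0"
    using uv(1,2) uv'(1,2) unfolding ord_ge_1_iff by blast+
  note mult_eq = umbilic_multiplicity_graph[OF r F crit]
  \<comment> \<open>The coefficients of \<open>y\<close> are the same in both cases; only the multiples of \<open>x\<close> are
    grouped differently, with respect to \<open>x\<close> in the first and \<open>x\<^sup>2\<close> in the second case.\<close>
  define q1 where "q1 = (\<lambda>p. ?c c + (?c d13 - ?c d31) * fst p + ((?c d04 - ?c d22) / 2 - ?c \<kappa> ^ 3) * snd p + v p)"
  define q2 where "q2 = (\<lambda>p. ?c b + (?c d22 - ?c \<kappa> ^ 3) * fst p + ?c d13 / 2 * snd p + v' p)"
  have hol_q: "holomorphic_at_origin q1" "holomorphic_at_origin q2"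
    unfolding q1_def q2_def by (intro hol_intros hol_uv)+
  have "umbilic_multiplicity (graph_param f) = 1" if "D12_umbilic a b c"
  proof -
    define p1 where "p1 = (\<lambda>p. ?c b - ?c a + ((?c d22 - ?c d40) / 2 + ?c \<kappa> ^ 3 + u p) * fst p)"
    define p2 where "p2 = (\<lambda>p. (?c d31 / 2 + u' p) * fst p)"
    have "quotient_dim (Idl\<^bsub>O2\<^esub> {germ_of (curv_b F), germ_of (curv_c F)}) = enat 1"
    proof (rule quotient_dim_germs[of _ _ p1 q1 p2 q2])
      show "holomorphic_at_origin p1" "holomorphic_at_origin p2"
        unfolding p1_def p2_def by (intro hol_intros hol_uv)+
      show "\<forall>\<^sub>F p in nhds (0, 0). curv_b F p = p1 p * fst p ^ 1 + q1 p * snd p"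
        using uv(3)
      proof eventually_elim
        case (elim p)
        show ?case
          unfolding elim[unfolded diff_eq_eq] p1_def q1_def by (simp add: field_simps power2_eq_square)
      qed
      show "\<forall>\<^sub>F p in nhds (0, 0). curv_c F p = p2 p * fst p ^ 1 + q2 p * snd p"
        using uv'(3)
      proof eventually_elim
        case (elim p)
        show ?case
          unfolding elim[unfolded diff_eq_eq] p2_def q2_def by (simp add: field_simps power2_eq_square)
      qed
      have "(b - a) * b \<noteq> 0" using that by (simp add: D12_umbilic_def)
      \<comment> \<open>The second germ has no linear term in \<open>x\<close>, so the determinant is \<open>(b - a) b\<close>.\<close>
      then have "?c ((b - a) * b) \<noteq> 0" unfolding of_real_eq_0_iff .
      then show "p1 (0, 0) * q2 (0, 0) - q1 (0, 0) * p2 (0, 0) \<noteq> 0"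
        by (simp add: p1_def p2_def q1_def q2_def uv0)
    qed (use hol_q holomorphic_at_origin_curv[OF hol] in simp_all)
    then show ?thesis unfolding mult_eq by (simp add: one_enat_def)
  qed
  moreover have "umbilic_multiplicity (graph_param f) = 2" if D: "D123_umbilic \<kappa> a b c d40 d31 d22"
  proof -
    have ab: "a = b" using D by (simp add: D123_umbilic_def)
    define p1 where "p1 = (\<lambda>p. (?c d22 - ?c d40) / 2 + ?c \<kappa> ^ 3 + u p)"
    define p2 where "p2 = (\<lambda>p. ?c d31 / 2 + u' p)"
    have "quotient_dim (Idl\<^bsub>O2\<^esub> {germ_of (curv_b F), germ_of (curv_c F)}) = enat 2"
    proof (rule quotient_dim_germs[of _ _ p1 q1 p2 q2])
      show "holomorphic_at_origin p1" "holomorphic_at_origin p2"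
        unfolding p1_def p2_def by (intro hol_intros hol_uv)+
      show "\<forall>\<^sub>F p in nhds (0, 0). curv_b F p = p1 p * fst p ^ 2 + q1 p * snd p"
        using uv(3)
      proof eventually_elim
        case (elim p)
        show ?case
          unfolding elim[unfolded diff_eq_eq] p1_def q1_def ab by (simp add: field_simps power2_eq_square)
      qed
      show "\<forall>\<^sub>F p in nhds (0, 0). curv_c F p = p2 p * fst p ^ 2 + q2 p * snd p"
        using uv'(3)
      proof eventually_elim
        case (elim p)
        show ?case
          unfolding elim[unfolded diff_eq_eq] p2_def q2_def by (simp add: field_simps power2_eq_square)
      qed
      have "- (c * d31 - (d22 - d40 + 2 * \<kappa> ^ 3) * b) / 2 \<noteq> 0"
        using D by (simp add: D123_umbilic_def)
      \<comment> \<open>The determinant is \<open>- \<chi> / 2\<close>.\<close>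
      then have "?c (- (c * d31 - (d22 - d40 + 2 * \<kappa> ^ 3) * b) / 2) \<noteq> 0"
        unfolding of_real_eq_0_iff .
      also have "?c (- (c * d31 - (d22 - d40 + 2 * \<kappa> ^ 3) * b) / 2) =
          p1 (0, 0) * q2 (0, 0) - q1 (0, 0) * p2 (0, 0)"
        by (simp add: p1_def p2_def q1_def q2_def uv0 field_simps)
      finally show "p1 (0, 0) * q2 (0, 0) - q1 (0, 0) * p2 (0, 0) \<noteq> 0" .
    qed (use hol_q holomorphic_at_origin_curv[OF hol] in simp_all)
    then show ?thesis unfolding mult_eq by (simp add: numeral_eq_enat)
  qed
  ultimately show ?thesis by blast
qed

end
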